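(* Let $G$ be a group acting on a field $L$ by automorphisms, let $K\subseteq L^G$ be a subring that is a Zacharias ring, and let $R=K[a_1,\dots,a_n]\subseteq L$ be a finitely generated $G$-stable $K$-subalgebra with $\operatorname{Quot}(R)=L$. Suppose given: the kernel $I$ of the map $K[y_1,\dots,y_n]\to R$, $y_i\mapsto a_i$; a subalgebra $B\subseteq R^G$ generated by elements $\overline f_i:=f_i(a_1,\dots,a_n)$ with $f_i\in K[y_1,\dots,y_n]$, $i=1,\dots,k$; and a nonzero element $a\in B$ such that $R^G_a=B_a$. Consider the following procedure. (1) Set $m:=k$. (2) Optionally, substitute $\{\overline f_1,\dots,\overline f_m\}$ by a (smaller) subset of $R$ generating the same subalgebra. (3) With additional indeterminates $z_1,\dots,z_m$, let $\widehat L\subseteq K[y_1,\dots,y_n,z_1,\dots,z_m]$ be the ideal generated by $I$ and $z_i-f_i$ ($i=1,\dots,m$). Let $\widehat M\subseteq K[y_1,\dots,y_n,z_1,\dots,z_m]$ be the ideal generated by $\widehat L$ and a polynomial $g\in K[z_1,\dots,z_m]$ with $g(\overline f_1,\dots,\overline f_m)=a$. (4) Compute $M:=K[z_1,\dots,z_m]\cap\widehat M$ and $J:=K[z_1,\dots,z_m]\cap\widehat L$, and let $N\subseteq K[z_1,\dots,z_m]$ be the ideal generated by $J$ and $g$. (5) If $M\subseteq N$, return $\overline f_1,\dots,\overline f_m$ and $J$, and stop. (6) Choose $h_1,\dots,h_r\in M$ such that $N$ together with the $h_i$ generates $M$. Compute a Gr\"obner basis of the ideal $J'\subseteq K[y_1,\dots,y_n]$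 generated by $I$ and $g(f_1,\dots,f_m)$, together with representations of the Gr\"obner basis elements as linear combinations of the original basis elements. (7) For each $i\in\{1,\dots,r\}$, reduce $h_i(f_1,\dots,f_m)$ with respect to this Gr\"obner basis (which yields zero) and thereby express $h_i(f_1,\dots,f_m)$ as a linear combination of the ideal basis of $I$ and $g(f_1,\dots,f_m)$; this yields $f_{m+i}\in K[y_1,\dots,y_n]$ such that, with $\overline f_{m+i}:=f_{m+i}(a_1,\dots,a_n)$, \[ g(\overline f_1,\dots,\overline f_m)\cdot\overline f_{m+i}=h_i(\overline f_1,\dots,\overline f_m). \] (8) Set $m:=m+r$ and go to step (2). Then the procedure is correct: whenever it returns $\overline f_1,\dots,\overline f_m$ and $J$, the elements $\overline f_1,\dots,\overline f_m$ generate $R^G$ as a $K$-algebra, and $J$ is the ideal of relations between them. The procedure terminates after finitely many steps if and only if $R^G$ is finitely generated.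
   Context: Rings are commutative with identity. $\operatorname{Quot}$ denotes the field of fractions. $B_a:=B[a^{-1}]\subseteq L$ and $R^G_a:=(R^G)[a^{-1}]\subseteq L$. A Zacharias ring is a Noetherian ring $K$ for which there is an algorithm for computing all solutions $(c_1,\dots,c_r)\in K^r$ of a linear equation $a_1c_1+\cdots+a_rc_r=b$ with $b,a_i\in K$; over such rings, Gr\"obner bases, ideal membership tests and elimination ideals in polynomial rings can be computed. *)

theory Defs
  imports
    "HOL-Algebra.Group_Action"
    "HOL-Algebra.Generated_Rings"
    "HOL-Algebra.Ring_Divisibility"
    "HOL-Library.Poly_Mapping"
    "HOL-Library.Nat_Bijection"
begin

text \<open>The ambient rings are types of class \<open>comm_ring_1\<close>; a subring \<open>S\<close> of such a type is
  turned into an object of HOL-Algebra by \<open>ring_on S\<close>.\<close>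

definition ring_on :: "'a::comm_ring_1 set \<Rightarrow> 'a ring" where
  "ring_on S = \<lparr>carrier = S, monoid.mult = (*), one = 1, ring.zero = 0, add = (+)\<rparr>"


section \<open>Zacharias rings\<close>

text \<open>\<open>recursive n f\<close>: the function \<open>f\<close> of \<open>n\<close> arguments, given as a function on
  lists of length \<open>n\<close>, is a (total) recursive function. Minimisation is only applied to
  regular functions, which yields exactly the total recursive functions (Kleene).\<close>

inductive recursive :: "nat \<Rightarrow> (nat list \<Rightarrow> nat) \<Rightarrow> bool" where
  zero: "recursive n (\<lambda>xs. 0)"
| succ: "recursive 1 (\<lambda>xs. Suc (xs ! 0))"
| proj: "i < n \<Longrightarrow> recursive n (\<lambda>xs. xs ! i)"
| comp: "\<lbrakk>recursive (length gs) f; \<And>g. g \<in> set gs \<Longrightarrow> recursive n g\<rbrakk>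
          \<Longrightarrow> recursive n (\<lambda>xs. f (map (\<lambda>g. g xs) gs))"
| prim_rec: "\<lbrakk>recursive n f; recursive (Suc (Suc n)) h\<rbrakk>
          \<Longrightarrow> recursive (Suc n) (\<lambda>xs. rec_nat (f (tl xs)) (\<lambda>y r. h (y # r # tl xs)) (hd xs))"
| minim: "\<lbrakk>recursive (Suc n) f; \<And>xs. length xs = n \<Longrightarrow> \<exists>y. f (y # xs) = 0\<rbrakk>
          \<Longrightarrow> recursive n (\<lambda>xs. LEAST y. f (y # xs) = 0)"

text \<open>An algorithm on \<open>K\<close> works on finite representations of ring elements. These are
  modelled by a numbering \<open>\<nu>\<close> of \<open>K\<close> (an element may have several codes) for which the ring
  operations are recursive.\<close>

definition computable_numbering :: "'a::comm_ring_1 set \<Rightarrow> (nat \<Rightarrow> 'a) \<Rightarrow> bool" where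
  "computable_numbering K \<nu> \<longleftrightarrow> range \<nu> = K
     \<and> (\<exists>A. recursive 2 A \<and> (\<forall>x y. \<nu> (A [x, y]) = \<nu> x + \<nu> y))
     \<and> (\<exists>A. recursive 1 A \<and> (\<forall>x. \<nu> (A [x]) = - \<nu> x))
     \<and> (\<exists>A. recursive 2 A \<and> (\<forall>x y. \<nu> (A [x, y]) = \<nu> x * \<nu> y))"

definition dot :: "'a::comm_ring_1 list \<Rightarrow> 'a list \<Rightarrow> 'a" where
  "dot as cs = (\<Sum>i<length as. as ! i * cs ! i)"

definition lin_solutions :: "'a::comm_ring_1 set \<Rightarrow> 'a list \<Rightarrow> 'a \<Rightarrow> 'a list set" where
  "lin_solutions K as b = {cs. length cs = length as \<and> set cs \<subseteq> K \<and> dot as cs = b}"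

text \<open>The solution set is output as a particular solution \<open>c\<close> together with finitely many
  generators \<open>ss\<close> of the module of solutions of the homogeneous equation.\<close>

definition solution_family :: "'a::comm_ring_1 set \<Rightarrow> nat \<Rightarrow> 'a list \<Rightarrow> 'a list list \<Rightarrow> 'a list set" where
  "solution_family K r c ss =
     {map (\<lambda>i. c ! i + (\<Sum>j<length ss. ds ! j * ss ! j ! i)) [0..<r] | ds.
        length ds = length ss \<and> set ds \<subseteq> K}"

text \<open>The input of the algorithm \<open>S\<close> is the code of the list \<open>b # as\<close>. Output \<open>0\<close> means that
  there is no solution.\<close>

definition zacharias_ring :: "'a::comm_ring_1 set \<Rightarrow> bool" where
  "zacharias_ring K \<longleftrightarrow> noetherian_ring (ring_on K) \<and>
     (\<exists>\<nu> S. computable_numbering K \<nu> \<and> recursive 1 S \<and>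
        (\<forall>b as. let out = S [list_encode (b # as)];
                    Sol = lin_solutions K (map \<nu> as) (\<nu> b) in
           if out = 0 then Sol = {}
           else \<exists>c ss. out = Suc (list_encode (map list_encode (c # ss)))
                 \<and> (\<forall>s \<in> set (c # ss). length s = length as)
                 \<and> Sol = solution_family K (length as) (map \<nu> c) (map (map \<nu>) ss)))"


section \<open>Polynomials\<close>

text \<open>The indeterminates \<open>y\<^sub>1,\<dots>,y\<^sub>n\<close> and \<open>z\<^sub>1,\<dots>,z\<^sub>m\<close> are
  \<open>Y 0,\<dots>,Y (n-1)\<close> and \<open>Z 0,\<dots>,Z (m-1)\<close>.\<close>

datatype indet = Y nat | Z nat

type_synonym monomial = "indet \<Rightarrow>\<^sub>0 nat"
type_synonym 'a mpol = "monomial \<Rightarrow>\<^sub>0 'a"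

definition Const :: "'a::comm_ring_1 \<Rightarrow> 'a mpol" where
  "Const c = Poly_Mapping.single 0 c"

definition Var :: "indet \<Rightarrow> 'a::comm_ring_1 mpol" where
  "Var v = Poly_Mapping.single (Poly_Mapping.single v 1) 1"

definition monomials :: "indet set \<Rightarrow> monomial set" where
  "monomials V = {t. Poly_Mapping.keys t \<subseteq> V}"

definition polys :: "'a::comm_ring_1 set \<Rightarrow> indet set \<Rightarrow> 'a mpol set" where
  "polys K V = {p. range (Poly_Mapping.lookup p) \<subseteq> K \<and> Poly_Mapping.keys p \<subseteq> monomials V}"

definition y_vars :: "nat \<Rightarrow> indet set" where "y_vars n = Y ` {..<n}"
definition z_vars :: "nat \<Rightarrow> indet set" where "z_vars m = Z ` {..<m}"

text \<open>Evaluation; the coefficients are mapped by \<open>h\<close>.\<close>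

definition eval_poly :: "('a::comm_ring_1 \<Rightarrow> 'b::comm_ring_1) \<Rightarrow> (indet \<Rightarrow> 'b) \<Rightarrow> 'a mpol \<Rightarrow> 'b" where
  "eval_poly h \<sigma> p = (\<Sum>t\<in>Poly_Mapping.keys p. h (Poly_Mapping.lookup p t) *
     (\<Prod>v\<in>Poly_Mapping.keys t. \<sigma> v ^ Poly_Mapping.lookup t v))"

text \<open>The following are only used for polynomials in \<open>y\<^sub>1,\<dots>,y\<^sub>n\<close> or
  \<open>z\<^sub>1,\<dots>,z\<^sub>m\<close> alone, where \<open>n\<close>, \<open>m\<close> is the length of the given list.\<close>

definition at_y :: "'a::comm_ring_1 list \<Rightarrow> 'a mpol \<Rightarrow> 'a" where
  "at_y as = eval_poly (\<lambda>c. c) (\<lambda>v. case v of Y i \<Rightarrow> as ! i | Z i \<Rightarrow> 0)"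

definition at_z :: "'a::comm_ring_1 list \<Rightarrow> 'a mpol \<Rightarrow> 'a" where
  "at_z bs = eval_poly (\<lambda>c. c) (\<lambda>v. case v of Y i \<Rightarrow> 0 | Z i \<Rightarrow> bs ! i)"

definition subst_z :: "'a::comm_ring_1 mpol list \<Rightarrow> 'a mpol \<Rightarrow> 'a mpol" where
  "subst_z fs = eval_poly Const (\<lambda>v. case v of Y i \<Rightarrow> 0 | Z i \<Rightarrow> fs ! i)"


section \<open>Groebner bases over rings\<close>

text \<open>Leading terms include the coefficient.\<close>

definition monomial_order :: "indet set \<Rightarrow> monomial rel \<Rightarrow> bool" where
  "monomial_order V ord \<longleftrightarrow> linear_order_on (monomials V) ord
     \<and> (\<forall>t\<in>monomials V. (0, t) \<in> ord)
     \<and> (\<forall>s\<in>monomials V. \<forall>t\<in>monomials V. \<forall>u\<in>monomials V. (s, t) \<in> ord \<longrightarrow> (s + u, t + u) \<in> ord)"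

definition lead_mon :: "monomial rel \<Rightarrow> 'a::comm_ring_1 mpol \<Rightarrow> monomial" where
  "lead_mon ord p = (THE t. t \<in> Poly_Mapping.keys p \<and> (\<forall>s\<in>Poly_Mapping.keys p. (s, t) \<in> ord))"

definition lead_term :: "monomial rel \<Rightarrow> 'a::comm_ring_1 mpol \<Rightarrow> 'a mpol" where
  "lead_term ord p = Poly_Mapping.single (lead_mon ord p) (Poly_Mapping.lookup p (lead_mon ord p))"

definition groebner_basis ::
    "'a::comm_ring_1 set \<Rightarrow> indet set \<Rightarrow> monomial rel \<Rightarrow> 'a mpol list \<Rightarrow> 'a mpol set \<Rightarrow> bool" where
  "groebner_basis K V ord gb J \<longleftrightarrow> set gb \<subseteq> J - {0}
     \<and> genideal (ring_on (polys K V)) (lead_term ord ` set gb)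
       = genideal (ring_on (polys K V)) (lead_term ord ` (J - {0}))"

text \<open>One reduction step over a coefficient ring: the leading term of \<open>p\<close> is cancelled by a
  combination, with coefficients that are terms \<open>ws ! j\<close> (or zero), of elements of \<open>gb\<close>. In
  general several elements of \<open>gb\<close> are needed for this.\<close>

definition reduces_by ::
    "'a::comm_ring_1 set \<Rightarrow> indet set \<Rightarrow> monomial rel \<Rightarrow> 'a mpol list \<Rightarrow> 'a mpol \<Rightarrow> 'a mpol list \<Rightarrow> bool" where
  "reduces_by K V ord gb p ws \<longleftrightarrow> p \<noteq> 0 \<and> length ws = length gb
     \<and> (\<forall>j<length gb. ws ! j \<in> polys K V
          \<and> (\<forall>t\<in>Poly_Mapping.keys (ws ! j). t + lead_mon ord (gb ! j) = lead_mon ord p))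
     \<and> lead_term ord p = (\<Sum>j<length gb. ws ! j * lead_term ord (gb ! j))"

text \<open>\<open>reduction K V ord gb p us q\<close>: finitely many reduction steps lead from \<open>p\<close> to \<open>q\<close>, and
  \<open>us\<close> collects the multipliers, so that \<open>p - q\<close> is the combination of \<open>gb\<close> with coefficients
  \<open>us\<close>.\<close>

inductive reduction ::
    "'a::comm_ring_1 set \<Rightarrow> indet set \<Rightarrow> monomial rel \<Rightarrow> 'a mpol list \<Rightarrow> 'a mpol \<Rightarrow> 'a mpol list \<Rightarrow> 'a mpol \<Rightarrow> bool"
  for K V ord gb p where
  start: "reduction K V ord gb p (replicate (length gb) 0) p"
| step: "\<lbrakk>reduction K V ord gb p us q; reduces_by K V ord gb q ws\<rbrakk>
          \<Longrightarrow> reduction K V ord gb p (map2 (+) us ws) (q - dot ws gb)"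

definition complete_reduction ::
    "'a::comm_ring_1 set \<Rightarrow> indet set \<Rightarrow> monomial rel \<Rightarrow> 'a mpol list \<Rightarrow> 'a mpol \<Rightarrow> 'a mpol list \<Rightarrow> 'a mpol \<Rightarrow> bool" where
  "complete_reduction K V ord gb p us q \<longleftrightarrow>
     reduction K V ord gb p us q \<and> (\<nexists>ws. reduces_by K V ord gb q ws)"


section \<open>Algebras and invariants\<close>

definition subalg :: "'a::comm_ring_1 set \<Rightarrow> 'a set \<Rightarrow> 'a set" where
  "subalg K S = generate_ring (ring_on UNIV) (K \<union> S)"

text \<open>\<open>S[a\<^sup>-\<^sup>1]\<close> inside the field\<close>

definition adjoin_inverse :: "'a::field set \<Rightarrow> 'a \<Rightarrow> 'a set" where
  "adjoin_inverse S a = generate_ring (ring_on UNIV) (insert (inverse a) S)"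

definition acts_by_automorphisms :: "('g, 'x) monoid_scheme \<Rightarrow> ('g \<Rightarrow> 'a::field \<Rightarrow> 'a) \<Rightarrow> bool" where
  "acts_by_automorphisms G \<phi> \<longleftrightarrow> group_action G UNIV \<phi>
     \<and> (\<forall>\<sigma>\<in>carrier G. \<phi> \<sigma> \<in> ring_iso (ring_on UNIV) (ring_on UNIV))"

text \<open>\<open>S\<^sup>G\<close>, for \<open>S\<close> the field or a stable subring\<close>

definition fixed_points :: "('g, 'x) monoid_scheme \<Rightarrow> ('g \<Rightarrow> 'a::field \<Rightarrow> 'a) \<Rightarrow> 'a set \<Rightarrow> 'a set" where
  "fixed_points G \<phi> S = (\<Inter>\<sigma>\<in>carrier G. invariants S \<phi> \<sigma>)"

definition fin_gen_algebra :: "'a::comm_ring_1 set \<Rightarrow> 'a set \<Rightarrow> bool" where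
  "fin_gen_algebra K A \<longleftrightarrow> (\<exists>S. finite S \<and> A = subalg K S)"

definition relation_ideal :: "'a::comm_ring_1 set \<Rightarrow> 'a list \<Rightarrow> 'a mpol set" where
  "relation_ideal K bs = a_kernel (ring_on (polys K (z_vars (length bs)))) (ring_on UNIV) (at_z bs)"


section \<open>The procedure\<close>

text \<open>In the following, \<open>\<alpha> = [a\<^sub>1,\<dots>,a\<^sub>n]\<close>, \<open>Ib\<close> is a list of generators (ideal basis) of \<open>I\<close>,
  and \<open>fs = [f\<^sub>1,\<dots>,f\<^sub>m]\<close> is the current list of polynomials.\<close>

definition ideal_I :: "'a::comm_ring_1 set \<Rightarrow> 'a list \<Rightarrow> 'a mpol set" where
  "ideal_I K \<alpha> = a_kernel (ring_on (polys K (y_vars (length \<alpha>)))) (ring_on (subalg K (set \<alpha>))) (at_y \<alpha>)"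

definition ideal_Lhat :: "'a::comm_ring_1 set \<Rightarrow> 'a list \<Rightarrow> 'a mpol list \<Rightarrow> 'a mpol set" where
  "ideal_Lhat K \<alpha> fs = genideal (ring_on (polys K (y_vars (length \<alpha>) \<union> z_vars (length fs))))
     (ideal_I K \<alpha> \<union> {Var (Z i) - fs ! i | i. i < length fs})"

definition ideal_Mhat :: "'a::comm_ring_1 set \<Rightarrow> 'a list \<Rightarrow> 'a mpol list \<Rightarrow> 'a mpol \<Rightarrow> 'a mpol set" where
  "ideal_Mhat K \<alpha> fs g = genideal (ring_on (polys K (y_vars (length \<alpha>) \<union> z_vars (length fs))))
     (insert g (ideal_Lhat K \<alpha> fs))"

definition ideal_M :: "'a::comm_ring_1 set \<Rightarrow> 'a list \<Rightarrow> 'a mpol list \<Rightarrow> 'a mpol \<Rightarrow> 'a mpol set" where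
  "ideal_M K \<alpha> fs g = polys K (z_vars (length fs)) \<inter> ideal_Mhat K \<alpha> fs g"

definition ideal_J :: "'a::comm_ring_1 set \<Rightarrow> 'a list \<Rightarrow> 'a mpol list \<Rightarrow> 'a mpol set" where
  "ideal_J K \<alpha> fs = polys K (z_vars (length fs)) \<inter> ideal_Lhat K \<alpha> fs"

definition ideal_N :: "'a::comm_ring_1 set \<Rightarrow> 'a list \<Rightarrow> 'a mpol list \<Rightarrow> 'a mpol \<Rightarrow> 'a mpol set" where
  "ideal_N K \<alpha> fs g = genideal (ring_on (polys K (z_vars (length fs)))) (insert g (ideal_J K \<alpha> fs))"

definition ideal_J' :: "'a::comm_ring_1 set \<Rightarrow> 'a list \<Rightarrow> 'a mpol list \<Rightarrow> 'a mpol \<Rightarrow> 'a mpol set" where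
  "ideal_J' K \<alpha> fs g = genideal (ring_on (polys K (y_vars (length \<alpha>)))) (insert (subst_z fs g) (ideal_I K \<alpha>))"

text \<open>\<open>At_k \<dots>\<close> is the state in which step (k) is about to be executed. \<open>At_4\<close> stands for steps (4) and
  (5), and \<open>At_6b\<close> for the Groebner basis computation in step (6), with respect to the
  monomial order \<open>ord\<close>, which may be chosen anew each time.
  In \<open>At_7\<close>, the \<open>j\<close>-th Groebner basis element is the combination of
  \<open>Ib @ [g(f\<^sub>1,\<dots>,f\<^sub>m)]\<close> with coefficient list \<open>reps ! j\<close>. In \<open>At_8\<close>, \<open>rems\<close> are the results of
  the reductions made in step (7), and \<open>new = [f\<^sub>m\<^sub>+\<^sub>1,\<dots>,f\<^sub>m\<^sub>+\<^sub>r]\<close>.\<close>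

datatype ('p, 'e) generic_state =
    At_2 "'p list"
  | At_3 "'p list"
  | At_4 "'p list" 'p
  | At_6 "'p list" 'p
  | At_6b "'p list" 'p "'p list" "monomial rel"
  | At_7 "'p list" 'p "'p list" "monomial rel" "'p list" "'p list list"
  | At_8 "'p list" 'p "'p list" "'p list" "'p list"
  | Returned "'e list" "'p set"

type_synonym 'a state = "('a mpol, 'a) generic_state"

text \<open>In step (2), the new elements of \<open>R\<close> are given by polynomials in \<open>y\<^sub>1,\<dots>,y\<^sub>n\<close> representing
  them; \<open>fs' = fs\<close> covers the case that the option is not used.\<close>

inductive step :: "'a::comm_ring_1 set \<Rightarrow> 'a list \<Rightarrow> 'a mpol list \<Rightarrow> 'a \<Rightarrow> 'a state \<Rightarrow> 'a state \<Rightarrow> bool"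
  for K \<alpha> Ib a where
  substitute:
    "\<lbrakk>set fs' \<subseteq> polys K (y_vars (length \<alpha>));
      subalg K (at_y \<alpha> ` set fs') = subalg K (at_y \<alpha> ` set fs)\<rbrakk>
     \<Longrightarrow> step K \<alpha> Ib a (At_2 fs) (At_3 fs')"
| choose_g:
    "\<lbrakk>g \<in> polys K (z_vars (length fs)); at_z (map (at_y \<alpha>) fs) g = a\<rbrakk>
     \<Longrightarrow> step K \<alpha> Ib a (At_3 fs) (At_4 fs g)"
| return:
    "ideal_M K \<alpha> fs g \<subseteq> ideal_N K \<alpha> fs g
     \<Longrightarrow> step K \<alpha> Ib a (At_4 fs g) (Returned (map (at_y \<alpha>) fs) (ideal_J K \<alpha> fs))"
| continue:
    "\<not> ideal_M K \<alpha> fs g \<subseteq> ideal_N K \<alpha> fs g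
     \<Longrightarrow> step K \<alpha> Ib a (At_4 fs g) (At_6 fs g)"
| choose_h:
    "\<lbrakk>set hs \<subseteq> ideal_M K \<alpha> fs g;
      genideal (ring_on (polys K (z_vars (length fs)))) (ideal_N K \<alpha> fs g \<union> set hs) = ideal_M K \<alpha> fs g;
      monomial_order (y_vars (length \<alpha>)) ord\<rbrakk>
     \<Longrightarrow> step K \<alpha> Ib a (At_6 fs g) (At_6b fs g hs ord)"
| groebner:
    "\<lbrakk>groebner_basis K (y_vars (length \<alpha>)) ord gb (ideal_J' K \<alpha> fs g);
      length reps = length gb;
      \<forall>j<length gb. length (reps ! j) = Suc (length Ib)
         \<and> set (reps ! j) \<subseteq> polys K (y_vars (length \<alpha>))
         \<and> gb ! j = dot (reps ! j) (Ib @ [subst_z fs g])\<rbrakk>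
     \<Longrightarrow> step K \<alpha> Ib a (At_6b fs g hs ord) (At_7 fs g hs ord gb reps)"
| reduce:
    "\<lbrakk>length us = length hs; length rems = length hs; length new = length hs;
      \<forall>i<length hs. complete_reduction K (y_vars (length \<alpha>)) ord gb (subst_z fs (hs ! i)) (us ! i) (rems ! i)
         \<and> new ! i = dot (us ! i) (map last reps)\<rbrakk>
     \<Longrightarrow> step K \<alpha> Ib a (At_7 fs g hs ord gb reps) (At_8 fs g hs rems new)"
| repeat:
    "step K \<alpha> Ib a (At_8 fs g hs rems new) (At_2 (fs @ new))"

definition returned :: "'a state \<Rightarrow> bool" where
  "returned s \<longleftrightarrow> (\<exists>bs J. s = Returned bs J)"

text \<open>An execution is one way of making all choices in the procedure. After a return, it stays
  in the final state, so that executions are infinite sequences.\<close>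

definition execution ::
    "'a::comm_ring_1 set \<Rightarrow> 'a list \<Rightarrow> 'a mpol list \<Rightarrow> 'a \<Rightarrow> 'a mpol list \<Rightarrow> (nat \<Rightarrow> 'a state) \<Rightarrow> bool" where
  "execution K \<alpha> Ib a fs \<rho> \<longleftrightarrow> \<rho> 0 = At_2 fs
     \<and> (\<forall>t. if returned (\<rho> t) then \<rho> (Suc t) = \<rho> t else step K \<alpha> Ib a (\<rho> t) (\<rho> (Suc t)))"

abbreviation reachable ::
    "'a::comm_ring_1 set \<Rightarrow> 'a list \<Rightarrow> 'a mpol list \<Rightarrow> 'a \<Rightarrow> 'a mpol list \<Rightarrow> 'a state \<Rightarrow> bool" where
  "reachable K \<alpha> Ib a fs s \<equiv> (step K \<alpha> Ib a)\<^sup>*\<^sup>* (At_2 fs) s"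

end

theory Submission
  imports Defs "HOL-Computational_Algebra.Polynomial"
begin

text \<open>
  The proof replaces the ideals of the procedure by subrings of the field. Let \<open>A\<close> be the algebra
  generated by the current elements \<open>f\<^sub>i(a\<^sub>1,\<dots>,a\<^sub>n)\<close>. Since \<open>J\<close> is the kernel of the evaluation
  \<open>K[z\<^sub>1,\<dots>,z\<^sub>m] \<rightarrow> A\<close>, the ideals \<open>M\<close> and \<open>N\<close> consist of the polynomials with values in
  \<open>a R \<inter> A\<close> and in \<open>a A\<close>, respectively (\<open>ideal_M_eq\<close>, \<open>ideal_N_eq\<close>). So the test \<open>M \<subseteq> N\<close> asks
  whether \<open>A\<close> is closed under those divisions by \<open>a\<close> that are possible in \<open>R\<close>, and otherwise the
  round adjoins all these quotients.

  Let \<open>x\<close> be an invariant. The assumption on the localizations provides a \<open>k\<close> with \<open>a\<^sup>k x \<in> A\<close>.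
  If \<open>A\<close> is closed under division by \<open>a\<close>, then \<open>x \<in> A\<close>; this is partial correctness
  (\<open>alg_eq_Inv_iff\<close>). In general \<open>x\<close> is reached after \<open>k\<close> further rounds (\<open>alg_append\<close>), so if
  finitely many invariants generate, the algebra exhausts the ring of invariants in finitely many rounds,
  and then the test succeeds because a quotient in \<open>R\<close> of invariants is invariant
  (\<open>termination_if_finitely_generated\<close>).

  That no step can get stuck (\<open>progress\<close>) rests on the basis theorem for polynomial rings over the
  Noetherian ring \<open>K\<close> (\<open>hilbert_basis\<close>, \<open>noetherian_on_polys\<close>). It provides finitely many \<open>h\<^sub>i\<close>, yields finite
  Groebner bases, and shows that monomial orders are well-founded, whence reductions end.
  Reducing an element of the ideal of a Groebner basis can only end with zero
  (\<open>groebner_basis_reduces\<close>), and the recorded multipliers give the new elements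
  (\<open>divided_by_a_reduction\<close>).
\<close>

section \<open>Subrings and generated ideals\<close>

abbreviation is_subring :: "'a::comm_ring_1 set \<Rightarrow> bool" where
  "is_subring S \<equiv> subring S (ring_on UNIV)"

lemma ring_on_simps [simp]:
  "carrier (ring_on S) = S" "x \<otimes>\<^bsub>ring_on S\<^esub> y = x * y" "\<one>\<^bsub>ring_on S\<^esub> = 1"
  "\<zero>\<^bsub>ring_on S\<^esub> = 0" "x \<oplus>\<^bsub>ring_on S\<^esub> y = x + y"
  by (simp_all add: ring_on_def)

lemma cring_ring_on_UNIV: "cring (ring_on (UNIV :: 'a::comm_ring_1 set))"
proof (rule cringI)
  show "abelian_group (ring_on (UNIV :: 'a set))"
    by (rule abelian_groupI) (auto simp: algebra_simps intro: exI[of _ "- _"] add.right_inverse)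
  show "comm_monoid (ring_on (UNIV :: 'a set))"
    by (rule comm_monoidI) (auto simp: algebra_simps)
qed (auto simp: algebra_simps)

lemma a_inv_ring_on_UNIV [simp]: "\<ominus>\<^bsub>ring_on UNIV\<^esub> x = - (x :: 'a::comm_ring_1)"
proof -
  interpret cring "ring_on (UNIV :: 'a set)" by (rule cring_ring_on_UNIV)
  have "- x \<oplus>\<^bsub>ring_on UNIV\<^esub> x = \<zero>\<^bsub>ring_on UNIV\<^esub>" by simp
  from minus_equality[OF this] show ?thesis by simp
qed

lemma is_subringI:
  assumes "1 \<in> S" "\<And>x. x \<in> S \<Longrightarrow> - x \<in> S" "\<And>x y. x \<in> S \<Longrightarrow> y \<in> S \<Longrightarrow> x * y \<in> S"
    "\<And>x y. x \<in> S \<Longrightarrow> y \<in> S \<Longrightarrow> x + y \<in> S"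
  shows "is_subring S"
proof -
  interpret cring "ring_on (UNIV :: 'a set)" by (rule cring_ring_on_UNIV)
  show ?thesis by (rule subringI) (use assms in auto)
qed

lemma is_subringD:
  assumes "is_subring S"
  shows "0 \<in> S" "1 \<in> S" "\<And>x. x \<in> S \<Longrightarrow> - x \<in> S" "\<And>x y. x \<in> S \<Longrightarrow> y \<in> S \<Longrightarrow> x * y \<in> S"
    "\<And>x y. x \<in> S \<Longrightarrow> y \<in> S \<Longrightarrow> x + y \<in> S" "\<And>x y. x \<in> S \<Longrightarrow> y \<in> S \<Longrightarrow> x - y \<in> S"
proof -
  show 1: "0 \<in> S" "1 \<in> S" "\<And>x. x \<in> S \<Longrightarrow> - x \<in> S" "\<And>x y. x \<in> S \<Longrightarrow> y \<in> S \<Longrightarrow> x * y \<in> S"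
    "\<And>x y. x \<in> S \<Longrightarrow> y \<in> S \<Longrightarrow> x + y \<in> S"
    using subringE[OF assms] by simp_all
  show "x \<in> S \<Longrightarrow> y \<in> S \<Longrightarrow> x - y \<in> S" for x y using 1(3)[of y] 1(5)[of x "- y"] by simp
qed

lemma is_subring_sum: "is_subring S \<Longrightarrow> (\<And>i. i \<in> A \<Longrightarrow> f i \<in> S) \<Longrightarrow> sum f A \<in> S"
  by (induction A rule: infinite_finite_induct) (auto simp: is_subringD)

lemma is_subring_prod: "is_subring S \<Longrightarrow> (\<And>i. i \<in> A \<Longrightarrow> f i \<in> S) \<Longrightarrow> prod f A \<in> S"
  by (induction A rule: infinite_finite_induct) (auto simp: is_subringD)

lemma is_subring_power: "is_subring S \<Longrightarrow> x \<in> S \<Longrightarrow> x ^ n \<in> S"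
  by (induction n) (auto simp: is_subringD)

lemma ring_ring_on: "is_subring S \<Longrightarrow> ring (ring_on S)"
  using ring.subring_is_ring[OF cring.axioms(1)[OF cring_ring_on_UNIV], of S]
  by (simp add: ring_on_def)

lemma is_subring_generate_ring: "is_subring (generate_ring (ring_on UNIV) H)"
  using ring.generate_ring_is_subring[OF cring.axioms(1)[OF cring_ring_on_UNIV], of H] by simp

lemma generate_ring_subset: "is_subring S \<Longrightarrow> H \<subseteq> S \<Longrightarrow> generate_ring (ring_on UNIV) H \<subseteq> S"
  using ring.generate_ring_min_subring1[OF cring.axioms(1)[OF cring_ring_on_UNIV], of H S] by simp

lemma is_subring_subalg: "is_subring (subalg K S)"
  unfolding subalg_def by (rule is_subring_generate_ring)

lemma subalg_incl: "K \<union> S \<subseteq> subalg K S"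
  unfolding subalg_def by (auto intro: generate_ring.incl)

lemma subalg_subset: "is_subring T \<Longrightarrow> K \<subseteq> T \<Longrightarrow> S \<subseteq> T \<Longrightarrow> subalg K S \<subseteq> T"
  unfolding subalg_def by (rule generate_ring_subset) auto

lemma subalg_mono: "S \<subseteq> T \<Longrightarrow> subalg K S \<subseteq> subalg K T"
  by (rule subalg_subset[OF is_subring_subalg]) (use subalg_incl[of K T] in auto)

text \<open>This is the ideal generated by \<open>A\<close> as soon as \<open>S\<close> is a subring containing \<open>A\<close>
  (\<open>genideal_eq_ideal_span\<close>). The inductive presentation builds an element by adding one multiple of
  a generator at a time, so that a property of ideal members is proved by a single induction.\<close>

inductive_set ideal_span :: "'a::comm_ring_1 set \<Rightarrow> 'a set \<Rightarrow> 'a set" for S A where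
  zero: "0 \<in> ideal_span S A"
| add: "\<lbrakk>c \<in> S; x \<in> A; y \<in> ideal_span S A\<rbrakk> \<Longrightarrow> c * x + y \<in> ideal_span S A"

lemma ideal_span_base: "is_subring S \<Longrightarrow> x \<in> A \<Longrightarrow> x \<in> ideal_span S A"
  using ideal_span.add[of 1 S x A 0] by (simp add: is_subringD ideal_span.zero)

lemma ideal_span_plus: "x \<in> ideal_span S A \<Longrightarrow> y \<in> ideal_span S A \<Longrightarrow> x + y \<in> ideal_span S A"
  by (induction rule: ideal_span.induct) (auto simp: add.assoc intro: ideal_span.intros)

lemma ideal_span_scale:
  assumes "is_subring S" "c \<in> S" shows "x \<in> ideal_span S A \<Longrightarrow> c * x \<in> ideal_span S A"
proof (induction rule: ideal_span.induct)
  case (add d x y)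
  have "c * (d * x + y) = (c * d) * x + c * y" by (simp add: algebra_simps)
  then show ?case using add assms by (auto intro!: ideal_span.intros simp: is_subringD)
qed (simp add: ideal_span.zero)

lemma ideal_span_diff:
  assumes "is_subring S" "x \<in> ideal_span S A" "y \<in> ideal_span S A" shows "x - y \<in> ideal_span S A"
  using ideal_span_plus[OF assms(2) ideal_span_scale[OF assms(1) _ assms(3), of "-1"]] assms(1)
  by (simp add: is_subringD)

lemma ideal_span_sum:
  "(\<And>i. i \<in> A \<Longrightarrow> f i \<in> ideal_span S B) \<Longrightarrow> sum f A \<in> ideal_span S B"
  by (induction A rule: infinite_finite_induct) (auto simp: ideal_span.zero ideal_span_plus)

lemma ideal_span_minimal:
  assumes "is_subring S" "A \<subseteq> ideal_span S B" shows "ideal_span S A \<subseteq> ideal_span S B"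
proof
  fix x assume "x \<in> ideal_span S A"
  then show "x \<in> ideal_span S B"
    by induction (use assms in \<open>auto intro: ideal_span_plus ideal_span_scale ideal_span.zero\<close>)
qed

lemma ideal_span_mono: "is_subring S \<Longrightarrow> A \<subseteq> B \<Longrightarrow> ideal_span S A \<subseteq> ideal_span S B"
  by (rule ideal_span_minimal) (auto intro: ideal_span_base)

lemma ideal_span_subset:
  assumes "is_subring S" "A \<subseteq> S" shows "ideal_span S A \<subseteq> S"
proof
  fix x assume "x \<in> ideal_span S A"
  then show "x \<in> S" by induction (use assms in \<open>auto simp: is_subringD\<close>)
qed

lemma ideal_span_finite_support:
  assumes S: "is_subring S" and "finite X" "X \<subseteq> ideal_span S A"
  shows "\<exists>F\<subseteq>A. finite F \<and> X \<subseteq> ideal_span S F"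
proof -
  have 1: "\<exists>F\<subseteq>A. finite F \<and> x \<in> ideal_span S F" if "x \<in> ideal_span S A" for x
    using that
  proof induction
    case (add c x y)
    then obtain F where F: "F \<subseteq> A" "finite F" "y \<in> ideal_span S F" by blast
    have "c * x + y \<in> ideal_span S (insert x F)"
      using add(1) F(3) ideal_span_mono[OF S, of F "insert x F"] by (blast intro: ideal_span.add)
    then show ?case using F add by (intro exI[of _ "insert x F"]) auto
  qed (auto intro: ideal_span.zero)
  from assms(2,3) show ?thesis
  proof (induction rule: finite_induct)
    case (insert x X)
    from insert.prems have "X \<subseteq> ideal_span S A" "x \<in> ideal_span S A" by simp_all
    then obtain F where F: "F \<subseteq> A" "finite F" "X \<subseteq> ideal_span S F" using insert.IH by blast
    from 1[OF \<open>x \<in> ideal_span S A\<close>] obtain F' where F': "F' \<subseteq> A" "finite F'" "x \<in> ideal_span S F'" by blast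
    have "insert x X \<subseteq> ideal_span S (F \<union> F')"
      using F(3) F'(3) ideal_span_mono[OF S, of F "F \<union> F'"] ideal_span_mono[OF S, of F' "F \<union> F'"]
      by blast
    then show ?case using F F' by (intro exI[of _ "F \<union> F'"]) auto
  qed auto
qed

text \<open>Membership in a finitely generated ideal, in terms of the coefficient lists that the procedure
  records for the elements of a Groebner basis.\<close>

lemma ideal_span_set_list:
  assumes S: "is_subring S"
  shows "ideal_span S (set xs) = {dot cs xs | cs. length cs = length xs \<and> set cs \<subseteq> S}"
proof (intro equalityI subsetI)
  fix x assume "x \<in> ideal_span S (set xs)"
  then show "x \<in> {dot cs xs | cs. length cs = length xs \<and> set cs \<subseteq> S}"
  proof induction
    case zero
    then show ?case
      by (intro CollectI exI[of _ "replicate (length xs) 0"])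
        (use S in \<open>auto simp: dot_def is_subringD\<close>)
  next
    case (add c x y)
    then obtain cs where cs: "length cs = length xs" "set cs \<subseteq> S" "y = dot cs xs" by blast
    from add obtain i where i: "i < length xs" "xs ! i = x" by (auto simp: in_set_conv_nth)
    let ?ds = "cs[i := cs ! i + c]"
    have "cs ! i \<in> S" using cs i nth_mem[of i cs] by auto
    then have "set ?ds \<subseteq> S" using set_update_subset_insert[of cs i "cs ! i + c"] cs(2) add(1) S
      by (auto simp: is_subringD)
    moreover have "dot ?ds xs = (\<Sum>j<length xs. cs ! j * xs ! j + (if j = i then c * x else 0))"
      unfolding dot_def using cs(1) i by (auto simp: nth_list_update algebra_simps intro!: sum.cong)
    then have "dot ?ds xs = c * x + y" using i cs by (simp add: sum.distrib dot_def add.commute)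
    ultimately show ?case using cs(1) by (intro CollectI exI[of _ ?ds]) auto
  qed
next
  fix x assume "x \<in> {dot cs xs | cs. length cs = length xs \<and> set cs \<subseteq> S}"
  then obtain cs where "x = dot cs xs" "length cs = length xs" "set cs \<subseteq> S" by blast
  then show "x \<in> ideal_span S (set xs)"
    unfolding dot_def
    by (auto intro!: ideal_span_sum ideal_span_scale[OF S _ ideal_span_base[OF S nth_mem]])
qed

lemma genideal_eq_ideal_span:
  assumes S: "is_subring S" and A: "A \<subseteq> S"
  shows "genideal (ring_on S) A = ideal_span S A"
proof -
  interpret ring "ring_on S" by (rule ring_ring_on[OF S])
  have neg: "\<ominus>\<^bsub>ring_on S\<^esub> x = - x" if "x \<in> S" for x
    using minus_equality[of "- x" x] that S by (simp add: is_subringD)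
  have "ideal (ideal_span S A) (ring_on S)"
  proof (rule idealI)
    show "subgroup (ideal_span S A) (add_monoid (ring_on S))"
    proof (rule add.subgroupI)
      show "\<ominus>\<^bsub>ring_on S\<^esub> x \<in> ideal_span S A" if "x \<in> ideal_span S A" for x
        using that ideal_span_subset[OF S A] neg ideal_span_diff[OF S ideal_span.zero that] by auto
    qed (use ideal_span_subset[OF S A] in \<open>auto intro: ideal_span_plus ideal_span.zero\<close>)
    show "x \<otimes>\<^bsub>ring_on S\<^esub> a \<in> ideal_span S A" "a \<otimes>\<^bsub>ring_on S\<^esub> x \<in> ideal_span S A"
      if "a \<in> ideal_span S A" "x \<in> carrier (ring_on S)" for a x
      using ideal_span_scale[OF S _ that(1), of x] that(2) by (simp_all add: mult.commute)
  qed (rule ring_axioms)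
  then have "genideal (ring_on S) A \<subseteq> ideal_span S A"
    by (rule genideal_minimal) (auto intro: ideal_span_base[OF S])
  moreover have "ideal_span S A \<subseteq> genideal (ring_on S) A"
  proof
    have id: "ideal (genideal (ring_on S) A) (ring_on S)" by (rule genideal_ideal) (use A in simp)
    have sub: "A \<subseteq> genideal (ring_on S) A" by (rule genideal_self) (use A in simp)
    fix x assume "x \<in> ideal_span S A"
    then show "x \<in> genideal (ring_on S) A"
    proof induction
      case zero
      then show ?case using additive_subgroup.zero_closed[OF ideal.axioms(1)[OF id]] by simp
    next
      case (add c x y)
      then show ?case
        using ideal.I_l_closed[OF id, of x c] sub
          additive_subgroup.a_closed[OF ideal.axioms(1)[OF id], of "c * x" y] by auto
    qed
  qed
  ultimately show ?thesis by blast
qed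


section \<open>Noetherian rings and the basis theorem\<close>

text \<open>The finitely many generators are taken from the arbitrary subset \<open>A\<close> itself. In this
  form the property directly provides Groebner bases (\<open>A\<close> consists of leading terms) and minimal
  monomials (\<open>A\<close> consists of monomials).\<close>

definition noetherian_on :: "'a::comm_ring_1 set \<Rightarrow> bool" where
  "noetherian_on S \<longleftrightarrow> (\<forall>A\<subseteq>S. \<exists>F\<subseteq>A. finite F \<and> A \<subseteq> ideal_span S F)"

text \<open>It suffices to find generators in the ideal generated by \<open>A\<close>: each of them involves only
  finitely many elements of \<open>A\<close>, and these do as well.\<close>

lemma noetherian_onI:
  assumes S: "is_subring S" and fg: "\<And>A. A \<subseteq> S \<Longrightarrow> \<exists>F\<subseteq>ideal_span S A. finite F \<and> A \<subseteq> ideal_span S F"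
  shows "noetherian_on S"
  unfolding noetherian_on_def
proof (intro allI impI)
  fix A assume "A \<subseteq> S"
  from fg[OF this] obtain F where F: "F \<subseteq> ideal_span S A" "finite F" "A \<subseteq> ideal_span S F" by blast
  obtain G where G: "G \<subseteq> A" "finite G" "F \<subseteq> ideal_span S G"
    using ideal_span_finite_support[OF S F(2,1)] by blast
  have "A \<subseteq> ideal_span S G" using F(3) ideal_span_minimal[OF S G(3)] by (rule subset_trans)
  with G(1,2) show "\<exists>F\<subseteq>A. finite F \<and> A \<subseteq> ideal_span S F" by auto
qed

lemma noetherian_on_of_noetherian_ring:
  assumes S: "is_subring S" and n: "noetherian_ring (ring_on S)"
  shows "noetherian_on S"
proof (rule noetherian_onI[OF S])
  fix A assume A: "A \<subseteq> S"
  interpret noetherian_ring "ring_on S" by fact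
  have "ideal (genideal (ring_on S) A) (ring_on S)" by (rule genideal_ideal) (use A in simp)
  from finetely_gen[OF this] obtain F where F: "F \<subseteq> S" "finite F"
    "genideal (ring_on S) A = genideal (ring_on S) F" by auto
  then have eq: "ideal_span S A = ideal_span S F"
    using genideal_eq_ideal_span[OF S A] genideal_eq_ideal_span[OF S F(1)] by simp
  have "F \<subseteq> ideal_span S A" unfolding eq by (auto intro: ideal_span_base[OF S])
  moreover have "A \<subseteq> ideal_span S F" unfolding eq[symmetric] by (auto intro: ideal_span_base[OF S])
  ultimately show "\<exists>F\<subseteq>ideal_span S A. finite F \<and> A \<subseteq> ideal_span S F"
    using F(2) by (intro exI[of _ F] conjI)
qed

lemma noetherian_on_sequence:
  fixes c :: "nat \<Rightarrow> 'a::comm_ring_1"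
  assumes S: "is_subring S" and n: "noetherian_on S" and c: "range c \<subseteq> S"
  shows "\<exists>n. c n \<in> ideal_span S (c ` {..<n})"
proof -
  obtain F where F: "F \<subseteq> range c" "finite F" "range c \<subseteq> ideal_span S F"
    using n[unfolded noetherian_on_def, rule_format, OF c] by blast
  obtain N where N: "finite N" "F = c ` N" using finite_subset_image[OF F(2,1)] by blast
  then obtain n where "N \<subseteq> {..<n}" using finite_nat_bounded by blast
  then have "F \<subseteq> c ` {..<n}" using N by auto
  then show ?thesis using F(3) ideal_span_mono[OF S] by blast
qed

text \<open>The ring \<open>S[x]\<close> inside a given ring. Univariate polynomials only parametrize it, so that a
  multivariate polynomial ring arises by adjoining its indeterminates one by one (\<open>polys_insert\<close>).\<close>

definition adjoin :: "'a::comm_ring_1 set \<Rightarrow> 'a \<Rightarrow> 'a set" where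
  "adjoin S x = {poly p x | p. \<forall>i. coeff p i \<in> S}"

lemma is_subring_polys_over:
  assumes S: "is_subring S" shows "is_subring {p. \<forall>i. coeff p i \<in> S}"
  by (rule is_subringI)
    (auto simp: coeff_mult one_pCons coeff_pCons is_subringD[OF S] split: nat.split intro!: is_subring_sum[OF S])

lemma is_subring_adjoin:
  assumes S: "is_subring S" shows "is_subring (adjoin S x)"
proof -
  note R = is_subringD[OF is_subring_polys_over[OF S]]
  show ?thesis
  proof (rule is_subringI)
    show "1 \<in> adjoin S x" unfolding adjoin_def using R(2) by (intro CollectI exI[of _ 1]) auto
  next
    fix u assume "u \<in> adjoin S x"
    then obtain p where "u = poly p x" "p \<in> {p. \<forall>i. coeff p i \<in> S}" unfolding adjoin_def by blast
    then show "- u \<in> adjoin S x"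
      unfolding adjoin_def using R(3)[of p] by (intro CollectI exI[of _ "- p"]) auto
  next
    fix u v assume "u \<in> adjoin S x" "v \<in> adjoin S x"
    then obtain p q where *: "u = poly p x" "p \<in> {p. \<forall>i. coeff p i \<in> S}"
       "v = poly q x" "q \<in> {p. \<forall>i. coeff p i \<in> S}" unfolding adjoin_def by blast
    then show "u * v \<in> adjoin S x"
      unfolding adjoin_def using R(4)[of p q] by (intro CollectI exI[of _ "p * q"]) auto
    show "u + v \<in> adjoin S x"
      unfolding adjoin_def using R(5)[of p q] * by (intro CollectI exI[of _ "p + q"]) auto
  qed
qed

text \<open>The classical argument: choose polynomials \<open>f\<^sub>0, f\<^sub>1, \<dots>\<close> successively, each of minimal degree
  among those whose value at \<open>x\<close> lies in the ideal but not in the ideal generated by the previous values. As \<open>S\<close>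
  is Noetherian, some leading coefficient is a combination of earlier ones, and subtracting the
  corresponding combination of shifted polynomials produces a choice of smaller degree.\<close>

lemma hilbert_basis:
  fixes x :: "'a::comm_ring_1"
  assumes S: "is_subring S" and noeth: "noetherian_on S"
  shows "noetherian_on (adjoin S x)"
proof (rule noetherian_onI[OF is_subring_adjoin[OF S]])
  fix A assume A: "A \<subseteq> adjoin S x"
  let ?T = "adjoin S x"
  note T = is_subring_adjoin[OF S, of x]
  define P where "P = ideal_span ?T A"
  show "\<exists>F\<subseteq>P. finite F \<and> A \<subseteq> ideal_span ?T F"
  proof (rule ccontr)
    assume contra: "\<not> ?thesis"
    define ok where "ok f n p \<longleftrightarrow> (\<forall>i. coeff p i \<in> S) \<and> poly p x \<in> P \<and>
        poly p x \<notin> ideal_span ?T ((\<lambda>k. poly (f k) x) ` {..<n})" for f :: "nat \<Rightarrow> 'a poly" and n :: nat and p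
    define best where "best f n p \<longleftrightarrow> ok f n p \<and> (\<forall>q. ok f n q \<longrightarrow> Polynomial.degree p \<le> Polynomial.degree q)"
      for f n p
    have "\<exists>f. \<forall>n. best f n (f n)"
    proof (rule dependent_wellorder_choice)
      fix n p and f g :: "nat \<Rightarrow> 'a poly" assume fg: "\<And>y. y < n \<Longrightarrow> f y = g y"
      have "(\<lambda>k. poly (f k) x) ` {..<n} = (\<lambda>k. poly (g k) x) ` {..<n}" using fg by auto
      then show "best f n p = best g n p" unfolding best_def ok_def by simp
    next
      fix n f assume best: "\<And>k. k < n \<Longrightarrow> best f k (f k)"
      then have sub: "(\<lambda>k. poly (f k) x) ` {..<n} \<subseteq> P" unfolding best_def ok_def by auto
      then have "\<not> A \<subseteq> ideal_span ?T ((\<lambda>k. poly (f k) x) ` {..<n})" using contra by blast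
      then obtain u where u: "u \<in> A" "u \<notin> ideal_span ?T ((\<lambda>k. poly (f k) x) ` {..<n})" by blast
      with A obtain p where "u = poly p x" "\<forall>i. coeff p i \<in> S" unfolding adjoin_def by blast
      then have "ok f n p" unfolding ok_def P_def using u ideal_span_base[OF T] by auto
      then show "\<exists>p. best f n p" unfolding best_def
        using ex_has_least_nat[of "ok f n" p Polynomial.degree] by blast
    qed
    then obtain f where f: "\<And>n. best f n (f n)" by blast
    define c where "c n = lead_coeff (f n)" for n
    have "range c \<subseteq> S" using f unfolding c_def best_def ok_def by auto
    from noetherian_on_sequence[OF S noeth this] obtain n where n: "c n \<in> ideal_span S (c ` {..<n})" by blast
    have deg: "Polynomial.degree (f k) \<le> Polynomial.degree (f n)" if "k < n" for k
    proof -
      have "ideal_span ?T ((\<lambda>k. poly (f k) x) ` {..<k}) \<subseteq> ideal_span ?T ((\<lambda>k. poly (f k) x) ` {..<n})"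
        by (rule ideal_span_mono[OF T]) (use that in auto)
      then have "ok f k (f n)" using f[of n] unfolding best_def ok_def by blast
      then show ?thesis using f[of k] unfolding best_def by blast
    qed
    let ?d = "Polynomial.degree (f n)"
    \<comment> \<open>Each combination of earlier leading coefficients is the coefficient in degree \<open>?d\<close> of a
      combination of the polynomials themselves, shifted to that degree.\<close>
    have lift: "\<exists>q. (\<forall>i. coeff q i \<in> S) \<and> Polynomial.degree q \<le> ?d \<and> coeff q ?d = s \<and>
        poly q x \<in> ideal_span ?T ((\<lambda>k. poly (f k) x) ` {..<n})" if "s \<in> ideal_span S (c ` {..<n})" for s
      using that
    proof induction
      case zero
      then show ?case by (intro exI[of _ 0]) (auto simp: is_subringD[OF S] ideal_span.zero)
    next
      case (add b y s)
      then obtain q where q: "\<forall>i. coeff q i \<in> S" "Polynomial.degree q \<le> ?d" "coeff q ?d = s"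
        "poly q x \<in> ideal_span ?T ((\<lambda>k. poly (f k) x) ` {..<n})" by blast
      from add obtain k where k: "k < n" "y = c k" by blast
      let ?e = "?d - Polynomial.degree (f k)"
      let ?m = "monom b ?e"
      have m: "\<forall>i. coeff ?m i \<in> S" using add(1) S by (auto simp: is_subringD)
      have fk: "\<forall>i. coeff (f k) i \<in> S" using f[of k] unfolding best_def ok_def by blast
      have "?m * f k + q \<in> {p. \<forall>i. coeff p i \<in> S}"
        by (intro is_subringD(4,5)[OF is_subring_polys_over[OF S]] CollectI m fk q(1))
      moreover have "Polynomial.degree (?m * f k + q) \<le> ?d"
      proof (rule degree_add_le)
        have "Polynomial.degree (?m * f k) \<le> Polynomial.degree ?m + Polynomial.degree (f k)" by (rule degree_mult_le)
        also have "\<dots> \<le> ?e + Polynomial.degree (f k)" by (simp add: degree_monom_le)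
        finally show "Polynomial.degree (?m * f k) \<le> ?d" using deg[OF k(1)] by simp
      qed (rule q(2))
      moreover have "coeff (?m * f k + q) ?d = b * y + s"
        using deg[OF k(1)] q(3) k(2) by (simp add: coeff_monom_mult c_def)
      moreover have "poly (?m * f k + q) x \<in> ideal_span ?T ((\<lambda>k. poly (f k) x) ` {..<n})"
      proof -
        have "poly ?m x \<in> ?T" unfolding adjoin_def using m by blast
        then show ?thesis using k(1) q(4) by (auto intro!: ideal_span.add)
      qed
      ultimately show ?case by (intro exI[of _ "?m * f k + q"]) auto
    qed
    from lift[OF n] obtain q where q: "\<forall>i. coeff q i \<in> S" "Polynomial.degree q \<le> ?d" "coeff q ?d = c n"
      "poly q x \<in> ideal_span ?T ((\<lambda>k. poly (f k) x) ` {..<n})" by blast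
    define r where "r = f n - q"
    have fn: "\<forall>i. coeff (f n) i \<in> S" "poly (f n) x \<in> P"
      "poly (f n) x \<notin> ideal_span ?T ((\<lambda>k. poly (f k) x) ` {..<n})"
      using f[of n] unfolding best_def ok_def by auto
    have "ideal_span ?T ((\<lambda>k. poly (f k) x) ` {..<n}) \<subseteq> P"
      unfolding P_def by (rule ideal_span_minimal[OF T]) (use f in \<open>auto simp: best_def ok_def P_def\<close>)
    then have rP: "poly r x \<in> P"
      using ideal_span_diff[OF T] fn(2) q(4) unfolding r_def P_def by auto
    have rn: "poly r x \<notin> ideal_span ?T ((\<lambda>k. poly (f k) x) ` {..<n})"
    proof
      assume "poly r x \<in> ideal_span ?T ((\<lambda>k. poly (f k) x) ` {..<n})"
      from ideal_span_plus[OF this q(4)] fn(3) show False by (simp add: r_def)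
    qed
    have "\<forall>i. coeff r i \<in> S" using fn(1) q(1) S by (auto simp: r_def is_subringD)
    then have "ok f n r" unfolding ok_def using rP rn by auto
    then have le: "?d \<le> Polynomial.degree r" using f[of n] unfolding best_def by blast
    have "Polynomial.degree r \<le> ?d" unfolding r_def using q(2) by (simp add: degree_diff_le)
    moreover have "coeff r ?d = 0" using q(3) by (simp add: r_def c_def)
    ultimately have "r = 0" using le by (metis antisym leading_coeff_0_iff)
    then show False using rn by (simp add: ideal_span.zero)
  qed
qed

section \<open>Polynomials and their evaluation\<close>

definition monomial_value :: "(indet \<Rightarrow> 'b::comm_ring_1) \<Rightarrow> monomial \<Rightarrow> 'b" where
  "monomial_value \<sigma> t = (\<Prod>v\<in>Poly_Mapping.keys t. \<sigma> v ^ Poly_Mapping.lookup t v)"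

lemma monomial_value_superset:
  assumes "finite A" "Poly_Mapping.keys t \<subseteq> A"
  shows "monomial_value \<sigma> t = (\<Prod>v\<in>A. \<sigma> v ^ Poly_Mapping.lookup t v)"
  unfolding monomial_value_def by (rule prod.mono_neutral_left) (use assms in \<open>auto simp: in_keys_iff\<close>)

lemma monomial_value_0 [simp]: "monomial_value \<sigma> 0 = 1"
  by (simp add: monomial_value_def)

lemma monomial_value_add: "monomial_value \<sigma> (s + t) = monomial_value \<sigma> s * monomial_value \<sigma> t"
proof -
  let ?A = "Poly_Mapping.keys s \<union> Poly_Mapping.keys t"
  have "monomial_value \<sigma> u = (\<Prod>v\<in>?A. \<sigma> v ^ Poly_Mapping.lookup u v)" if "u \<in> {s, t, s + t}" for u
    by (rule monomial_value_superset) (use that keys_add[of s t] in auto)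
  then show ?thesis by (simp add: lookup_add power_add prod.distrib)
qed

lemma sum_single_keys: "(\<Sum>t\<in>Poly_Mapping.keys p. Poly_Mapping.single t (Poly_Mapping.lookup p t)) = p"
  by (rule poly_mapping_eqI) (auto simp: lookup_sum lookup_single when_def in_keys_iff)

lemma mult_sum_single:
  "p * q = (\<Sum>s\<in>Poly_Mapping.keys p. \<Sum>t\<in>Poly_Mapping.keys q.
     Poly_Mapping.single (s + t) (Poly_Mapping.lookup p s * Poly_Mapping.lookup (q :: 'a::comm_ring_1 mpol) t))"
proof -
  have "p * q = (\<Sum>s\<in>Poly_Mapping.keys p. Poly_Mapping.single s (Poly_Mapping.lookup p s)) *
      (\<Sum>t\<in>Poly_Mapping.keys q. Poly_Mapping.single t (Poly_Mapping.lookup q t))"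
    by (simp add: sum_single_keys)
  then show ?thesis by (simp add: sum_product mult_single)
qed

definition ring_map :: "('a::comm_ring_1 \<Rightarrow> 'b::comm_ring_1) \<Rightarrow> bool" where
  "ring_map h \<longleftrightarrow> h 0 = 0 \<and> h 1 = 1 \<and> (\<forall>x y. h (x + y) = h x + h y) \<and> (\<forall>x y. h (x * y) = h x * h y)"

lemma ring_map_simps:
  assumes "ring_map h"
  shows "h 0 = 0" "h 1 = 1" "h (x + y) = h x + h y" "h (x * y) = h x * h y" "h (- x) = - h x"
    "h (x - y) = h x - h y"
proof -
  show *: "h 0 = 0" "h 1 = 1" "h (x + y) = h x + h y" "h (x * y) = h x * h y" for x y
    using assms by (auto simp: ring_map_def)
  show **: "h (- x) = - h x" for x using *(3)[of x "- x"] *(1) by (simp add: minus_unique)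
  show "h (x - y) = h x - h y" using *(3)[of x "- y"] ** by simp
qed

lemma ring_map_sum: "ring_map h \<Longrightarrow> h (sum f A) = (\<Sum>i\<in>A. h (f i))"
  by (induction A rule: infinite_finite_induct) (simp_all add: ring_map_simps)

lemma ring_map_prod: "ring_map h \<Longrightarrow> h (prod f A) = (\<Prod>i\<in>A. h (f i))"
  by (induction A rule: infinite_finite_induct) (simp_all add: ring_map_simps)

lemma ring_map_power: "ring_map h \<Longrightarrow> h (x ^ n) = h x ^ n"
  by (induction n) (simp_all add: ring_map_simps)

lemma is_subring_image: "ring_map h \<Longrightarrow> is_subring S \<Longrightarrow> is_subring (h ` S)"
  by (rule is_subringI)
    (auto simp: ring_map_simps(3-5)[symmetric] is_subringD intro: image_eqI[of _ _ 1] simp: ring_map_simps(2))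

lemma ring_map_id: "ring_map (\<lambda>c. c)" by (simp add: ring_map_def)

lemma ring_map_Const: "ring_map Const"
  by (simp add: ring_map_def Const_def single_add mult_single)

lemma eval_poly_superset:
  assumes "ring_map h" "finite A" "Poly_Mapping.keys p \<subseteq> A"
  shows "eval_poly h \<sigma> p = (\<Sum>t\<in>A. h (Poly_Mapping.lookup p t) * monomial_value \<sigma> t)"
  unfolding eval_poly_def monomial_value_def
  by (rule sum.mono_neutral_left) (use assms in \<open>auto simp: in_keys_iff ring_map_simps\<close>)

lemma eval_poly_single:
  "ring_map h \<Longrightarrow> eval_poly h \<sigma> (Poly_Mapping.single t c) = h c * monomial_value \<sigma> t"
  by (subst eval_poly_superset[of h "{t}"]) auto

lemma eval_poly_add:
  assumes "ring_map h" shows "eval_poly h \<sigma> (p + q) = eval_poly h \<sigma> p + eval_poly h \<sigma> q"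
proof -
  let ?A = "Poly_Mapping.keys p \<union> Poly_Mapping.keys q"
  have "eval_poly h \<sigma> r = (\<Sum>t\<in>?A. h (Poly_Mapping.lookup r t) * monomial_value \<sigma> t)"
    if "r \<in> {p, q, p + q}" for r
    by (rule eval_poly_superset) (use that assms keys_add[of p q] in auto)
  then show ?thesis using assms by (simp add: lookup_add ring_map_simps distrib_right sum.distrib)
qed

lemma ring_map_eval_poly:
  assumes h: "ring_map h" shows "ring_map (eval_poly h \<sigma>)"
proof -
  have 0: "eval_poly h \<sigma> 0 = 0" by (simp add: eval_poly_def)
  have sum: "eval_poly h \<sigma> (sum f A) = (\<Sum>i\<in>A. eval_poly h \<sigma> (f i))" for f and A :: "monomial set"
    by (induction A rule: infinite_finite_induct) (simp_all add: 0 eval_poly_add[OF h])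
  have "eval_poly h \<sigma> (p * q) = eval_poly h \<sigma> p * eval_poly h \<sigma> q" for p q
    by (subst mult_sum_single)
      (simp add: sum eval_poly_single[OF h] eval_poly_superset[OF h, where p = p, OF finite_keys order_refl]
        eval_poly_superset[OF h, where p = q, OF finite_keys order_refl] sum_product monomial_value_add
        ring_map_simps(4)[OF h] ac_simps)
  moreover have "eval_poly h \<sigma> 1 = 1"
    using eval_poly_single[OF h, of \<sigma> 0 1] by (simp add: ring_map_simps(2)[OF h])
  ultimately show ?thesis using 0 eval_poly_add[OF h] by (simp add: ring_map_def)
qed

lemma eval_poly_Const: "ring_map h \<Longrightarrow> eval_poly h \<sigma> (Const c) = h c"
  by (simp add: Const_def eval_poly_single)

lemma eval_poly_Var: "ring_map h \<Longrightarrow> eval_poly h \<sigma> (Var v) = \<sigma> v"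
  unfolding Var_def by (simp add: eval_poly_single ring_map_simps) (simp add: monomial_value_def)

lemma eval_poly_comp:
  assumes "ring_map e"
  shows "e (eval_poly h \<sigma> p) = eval_poly (\<lambda>c. e (h c)) (\<lambda>v. e (\<sigma> v)) p"
  using assms by (simp add: eval_poly_def ring_map_sum ring_map_prod ring_map_power ring_map_simps)

lemma in_polys_iff:
  "p \<in> polys K V \<longleftrightarrow> (\<forall>t. Poly_Mapping.lookup p t \<in> K) \<and> (\<forall>t\<in>Poly_Mapping.keys p. Poly_Mapping.keys t \<subseteq> V)"
  by (auto simp: polys_def monomials_def)

lemma polys_mono: "V \<subseteq> W \<Longrightarrow> polys K V \<subseteq> polys K W"
  by (fastforce simp: in_polys_iff)

lemma eval_poly_cong:
  assumes "p \<in> polys K V" "\<And>c. c \<in> K \<Longrightarrow> h c = h' c" "\<And>v. v \<in> V \<Longrightarrow> \<sigma> v = \<tau> v"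
  shows "eval_poly h \<sigma> p = eval_poly h' \<tau> p"
  unfolding eval_poly_def
proof (intro sum.cong refl arg_cong2[where f = "(*)"] prod.cong arg_cong2[where f = "(^)"])
  fix t v assume "t \<in> Poly_Mapping.keys p" "v \<in> Poly_Mapping.keys t"
  then have "v \<in> V" using assms(1) unfolding in_polys_iff by blast
  then show "\<sigma> v = \<tau> v" by (rule assms(3))
qed (use assms in \<open>auto simp: in_polys_iff\<close>)

lemma eval_poly_in_subring:
  assumes T: "is_subring T" and "p \<in> polys K V" "h ` K \<subseteq> T" "\<sigma> ` V \<subseteq> T"
  shows "eval_poly h \<sigma> p \<in> T"
  unfolding eval_poly_def
proof (intro is_subring_sum[OF T] is_subringD(4)[OF T] is_subring_prod[OF T] is_subring_power[OF T])
  fix t v assume "t \<in> Poly_Mapping.keys p" "v \<in> Poly_Mapping.keys t"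
  then have "v \<in> V" using assms(2) unfolding in_polys_iff by blast
  then show "\<sigma> v \<in> T" using assms(4) by blast
qed (use assms in \<open>auto simp: in_polys_iff\<close>)

lemma single_in_polys:
  "is_subring K \<Longrightarrow> c \<in> K \<Longrightarrow> t \<in> monomials V \<Longrightarrow> Poly_Mapping.single t c \<in> polys K V"
  by (auto simp: polys_def lookup_single when_def is_subringD)

lemma is_subring_polys:
  assumes K: "is_subring K" shows "is_subring (polys K V)"
proof -
  have add: "p + q \<in> polys K V" if "p \<in> polys K V" "q \<in> polys K V" for p q
    using that keys_add[of p q] is_subringD(5)[OF K] unfolding in_polys_iff lookup_add by blast
  have sum: "sum f A \<in> polys K V" if "\<And>i. i \<in> A \<Longrightarrow> f i \<in> polys K V" for f and A :: "monomial set"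
    using that by (induction A rule: infinite_finite_induct)
      (auto simp: add, auto simp: polys_def is_subringD[OF K])
  have "1 \<in> polys K V"
    using single_in_polys[OF K, of 1 0 V] K by (simp add: is_subringD monomials_def)
  moreover have "- p \<in> polys K V" if "p \<in> polys K V" for p
    using that K by (auto simp: polys_def is_subringD in_keys_iff)
  moreover have "p * q \<in> polys K V" if "p \<in> polys K V" "q \<in> polys K V" for p q
  proof (subst mult_sum_single, intro sum single_in_polys[OF K] is_subringD(4)[OF K])
    fix s t assume "s \<in> Poly_Mapping.keys p" "t \<in> Poly_Mapping.keys q"
    then have "s \<in> monomials V" "t \<in> monomials V" using that by (auto simp: polys_def)
    then show "s + t \<in> monomials V" unfolding monomials_def using keys_add[of s t] by blast
  qed (use that in \<open>auto simp: in_polys_iff\<close>)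
  ultimately show ?thesis by (intro is_subringI add)
qed

lemma Const_in_polys: "is_subring K \<Longrightarrow> c \<in> K \<Longrightarrow> Const c \<in> polys K V"
  unfolding Const_def by (rule single_in_polys) (auto simp: monomials_def)

lemma Var_in_polys: "is_subring K \<Longrightarrow> v \<in> V \<Longrightarrow> Var v \<in> polys K V"
  unfolding Var_def by (rule single_in_polys) (auto simp: monomials_def is_subringD)

lemma Var_power: "Var v ^ e = Poly_Mapping.single (Poly_Mapping.single v e) (1 :: 'a::comm_ring_1)"
  by (induction e) (simp_all add: Var_def mult_single single_add[symmetric])

lemma prod_single_one:
  "(\<Prod>v\<in>A. Poly_Mapping.single (f v) (1 :: 'a::comm_ring_1)) = Poly_Mapping.single (\<Sum>v\<in>A. f v :: monomial) 1"
  by (induction A rule: infinite_finite_induct) (simp_all add: mult_single)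

text \<open>Every polynomial is its own value at the indeterminates. In this way statements about evaluation
  yield statements about polynomials.\<close>

lemma eval_poly_Const_Var: "eval_poly Const Var p = (p :: 'a::comm_ring_1 mpol)"
proof -
  have "(\<Prod>v\<in>Poly_Mapping.keys t. Var v ^ Poly_Mapping.lookup t v) = Poly_Mapping.single t (1::'a)" for t
    by (simp add: Var_power prod_single_one sum_single_keys)
  then show ?thesis by (simp add: eval_poly_def Const_def mult_single sum_single_keys)
qed

text \<open>This serves as an induction principle: to prove a property of all polynomials, show that the
  polynomials with the property form a subring containing the constants and the indeterminates.\<close>

lemma polys_subset_subring:
  assumes "is_subring T" "Const ` K \<subseteq> T" "Var ` V \<subseteq> T"
  shows "polys K V \<subseteq> T"
proof
  fix p assume "p \<in> polys K V"
  from eval_poly_in_subring[OF assms(1) this assms(2,3)] show "p \<in> T" by (simp add: eval_poly_Const_Var)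
qed

lemma eval_poly_image:
  assumes K: "is_subring K"
  shows "eval_poly (\<lambda>c. c) \<sigma> ` polys K V = subalg K (\<sigma> ` V)"
proof
  show "eval_poly (\<lambda>c. c) \<sigma> ` polys K V \<subseteq> subalg K (\<sigma> ` V)"
    using subalg_incl[of K "\<sigma> ` V"] by (auto intro!: eval_poly_in_subring[OF is_subring_subalg])
  show "subalg K (\<sigma> ` V) \<subseteq> eval_poly (\<lambda>c. c) \<sigma> ` polys K V"
  proof (rule subalg_subset)
    show "is_subring (eval_poly (\<lambda>c. c) \<sigma> ` polys K V)"
      by (intro is_subring_image ring_map_eval_poly ring_map_id is_subring_polys[OF K])
    show "K \<subseteq> eval_poly (\<lambda>c. c) \<sigma> ` polys K V"
      by (auto simp: eval_poly_Const[OF ring_map_id] intro!: image_eqI[OF _ Const_in_polys[OF K]])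
    show "\<sigma> ` V \<subseteq> eval_poly (\<lambda>c. c) \<sigma> ` polys K V"
      by (auto simp: eval_poly_Var[OF ring_map_id] intro!: image_eqI[OF _ Var_in_polys[OF K]])
  qed
qed

lemma noetherian_on_Const:
  assumes "noetherian_on K" shows "noetherian_on (Const ` K)"
  unfolding noetherian_on_def
proof (intro allI impI)
  fix A assume "A \<subseteq> Const ` K"
  then obtain A' where A': "A' \<subseteq> K" "A = Const ` A'" by (rule subset_imageE)
  with assms obtain F where F: "F \<subseteq> A'" "finite F" "A' \<subseteq> ideal_span K F"
    unfolding noetherian_on_def by blast
  have "Const x \<in> ideal_span (Const ` K) (Const ` F)" if "x \<in> ideal_span K F" for x
    using that by induction
      (auto simp: ring_map_simps[OF ring_map_Const] intro: ideal_span.intros)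
  with F A' show "\<exists>F\<subseteq>A. finite F \<and> A \<subseteq> ideal_span (Const ` K) F"
    by (intro exI[of _ "Const ` F"]) auto
qed

lemma polys_empty: "is_subring K \<Longrightarrow> polys K {} = Const ` K"
proof
  assume K: "is_subring K"
  show "polys K {} \<subseteq> Const ` K"
    by (rule polys_subset_subring) (auto intro: is_subring_image[OF ring_map_Const K])
qed (auto intro: Const_in_polys)

lemma polys_insert:
  assumes K: "is_subring K"
  shows "polys K (insert v V) = adjoin (polys K V) (Var v)"
proof
  note S = is_subring_polys[OF K]
  have incl: "polys K V \<subseteq> adjoin (polys K V) (Var v)"
    unfolding adjoin_def by (auto intro!: exI[of _ "[:_:]"] simp: coeff_pCons is_subringD[OF S] split: nat.split)
  show "polys K (insert v V) \<subseteq> adjoin (polys K V) (Var v)"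
  proof (rule polys_subset_subring)
    show "is_subring (adjoin (polys K V) (Var v))" by (rule is_subring_adjoin[OF S])
    show "Const ` K \<subseteq> adjoin (polys K V) (Var v)" using incl Const_in_polys[OF K] by blast
    have "Var v \<in> adjoin (polys K V) (Var v)"
      unfolding adjoin_def
      by (auto intro!: exI[of _ "[:0, 1:]"] simp: coeff_pCons is_subringD[OF S] split: nat.split)
    then show "Var ` insert v V \<subseteq> adjoin (polys K V) (Var v)" using incl Var_in_polys[OF K] by blast
  qed
  show "adjoin (polys K V) (Var v) \<subseteq> polys K (insert v V)"
  proof
    fix u assume "u \<in> adjoin (polys K V) (Var v)"
    then obtain p where p: "u = poly p (Var v)" "\<forall>i. coeff p i \<in> polys K V" unfolding adjoin_def by blast
    show "u \<in> polys K (insert v V)"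
      unfolding p(1) poly_altdef
      using p(2) polys_mono[of V "insert v V" K]
      by (auto intro!: is_subring_sum[OF S] is_subringD(4)[OF S] is_subring_power[OF S] Var_in_polys[OF K])
  qed
qed

lemma noetherian_on_polys:
  assumes K: "is_subring K" "noetherian_on K" and V: "finite V"
  shows "noetherian_on (polys K V)"
  using V
proof (induction V rule: finite_induct)
  case empty
  then show ?case using K by (simp add: polys_empty noetherian_on_Const)
next
  case (insert v V)
  then show ?case using K by (simp add: polys_insert hilbert_basis is_subring_polys)
qed

section \<open>The ideals of the procedure\<close>

text \<open>The ideals \<open>ideal_Mhat\<close>, \<open>ideal_N\<close> and \<open>ideal_J'\<close> all arise by adding one element to the kernel of an evaluation
  map. An element belongs to such an ideal iff its value is a multiple of the value of \<open>g\<close>, the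
  cofactor being a value as well: subtracting the multiple leaves an element of the kernel. This translates
  statements about these ideals into statements about subrings of the field.\<close>

lemma ideal_span_insert_kernel:
  assumes S: "is_subring S" and e: "ring_map e" and g: "g \<in> S"
  shows "ideal_span S (insert g {x \<in> S. e x = 0}) = {p \<in> S. \<exists>q\<in>S. e p = e g * e q}"
proof (intro equalityI subsetI)
  let ?A = "insert g {x \<in> S. e x = 0}"
  fix p assume "p \<in> ideal_span S ?A"
  then show "p \<in> {p \<in> S. \<exists>q\<in>S. e p = e g * e q}"
  proof induction
    case zero
    then show ?case using is_subringD(1)[OF S] by (auto simp: ring_map_simps[OF e] intro!: bexI[of _ 0])
  next
    case (add c x y)
    then obtain q where q: "y \<in> S" "q \<in> S" "e y = e g * e q" by blast
    have "c * x + y \<in> S" using add q g by (auto simp: is_subringD[OF S])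
    moreover have "\<exists>r\<in>S. e (c * x + y) = e g * e r"
    proof (cases "x = g")
      case True
      then show ?thesis using add q
        by (auto simp: ring_map_simps[OF e] is_subringD[OF S] algebra_simps intro!: bexI[of _ "c + q"])
    next
      case False
      then show ?thesis using add q by (auto simp: ring_map_simps[OF e] intro!: bexI[of _ q])
    qed
    ultimately show ?case by blast
  qed
next
  fix p assume "p \<in> {p \<in> S. \<exists>q\<in>S. e p = e g * e q}"
  then obtain q where q: "p \<in> S" "q \<in> S" "e p = e g * e q" by blast
  have "p - q * g \<in> {x \<in> S. e x = 0}"
    using q g by (auto simp: ring_map_simps[OF e] is_subringD[OF S] algebra_simps)
  then have "q * g + (p - q * g) \<in> ideal_span S (insert g {x \<in> S. e x = 0})"
    using q(2) by (intro ideal_span.add ideal_span_base[OF S]) auto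
  then show "p \<in> ideal_span S (insert g {x \<in> S. e x = 0})" by simp
qed

lemma ring_map_at_y: "ring_map (at_y \<alpha>)" and ring_map_at_z: "ring_map (at_z bs)"
  unfolding at_y_def at_z_def by (intro ring_map_eval_poly ring_map_id)+

lemma image_nth_lessThan: "(\<lambda>i. xs ! i) ` {..<length xs} = set xs"
  by (auto simp: set_conv_nth)

lemma at_y_image: "is_subring K \<Longrightarrow> at_y \<alpha> ` polys K (y_vars (length \<alpha>)) = subalg K (set \<alpha>)"
  unfolding at_y_def by (simp add: eval_poly_image y_vars_def image_image image_nth_lessThan)

lemma at_z_image: "is_subring K \<Longrightarrow> at_z bs ` polys K (z_vars (length bs)) = subalg K (set bs)"
  unfolding at_z_def by (simp add: eval_poly_image z_vars_def image_image image_nth_lessThan)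

lemma subst_z_in_polys:
  assumes K: "is_subring K" and "set fs \<subseteq> polys K V" and "p \<in> polys K (z_vars (length fs))"
  shows "subst_z fs p \<in> polys K V"
  unfolding subst_z_def
  by (rule eval_poly_in_subring[OF is_subring_polys[OF K] assms(3)])
    (use assms in \<open>auto simp: z_vars_def Const_in_polys[OF K]\<close>)

locale generated_algebra =
  fixes K :: "'a::comm_ring_1 set" and \<alpha> :: "'a list"
  assumes K: "is_subring K"
begin

abbreviation "Ky \<equiv> polys K (y_vars (length \<alpha>))"
abbreviation "Kz fs \<equiv> polys K (z_vars (length (fs :: 'a mpol list)))"
abbreviation "Kyz fs \<equiv> polys K (y_vars (length \<alpha>) \<union> z_vars (length (fs :: 'a mpol list)))"
abbreviation "vals fs \<equiv> map (at_y \<alpha>) fs"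

text \<open>Evaluation at \<open>y\<^sub>i = a\<^sub>i\<close> and \<open>z\<^sub>i = f\<^sub>i(a\<^sub>1,\<dots>,a\<^sub>n)\<close>, which extends both \<open>at_y\<close> and \<open>at_z\<close>.\<close>

definition eval_yz :: "'a mpol list \<Rightarrow> 'a mpol \<Rightarrow> 'a" where
  "eval_yz fs = eval_poly (\<lambda>c. c) (\<lambda>v. case v of Y i \<Rightarrow> \<alpha> ! i | Z i \<Rightarrow> at_y \<alpha> (fs ! i))"

lemma ring_map_eval_yz: "ring_map (eval_yz fs)"
  unfolding eval_yz_def by (intro ring_map_eval_poly ring_map_id)

lemma eval_yz_at_y: "p \<in> Ky \<Longrightarrow> eval_yz fs p = at_y \<alpha> p"
  unfolding eval_yz_def at_y_def by (erule eval_poly_cong) (auto simp: y_vars_def)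

lemma eval_yz_at_z: "p \<in> Kz fs \<Longrightarrow> eval_yz fs p = at_z (vals fs) p"
  unfolding eval_yz_def at_z_def by (erule eval_poly_cong) (auto simp: z_vars_def)

lemma at_y_subst_z:
  assumes "p \<in> Kz fs" shows "at_y \<alpha> (subst_z fs p) = at_z (vals fs) p"
proof -
  have "at_y \<alpha> (subst_z fs p) =
      eval_poly (\<lambda>c. at_y \<alpha> (Const c)) (\<lambda>v. at_y \<alpha> (case v of Y i \<Rightarrow> 0 | Z i \<Rightarrow> fs ! i)) p"
    unfolding subst_z_def by (rule eval_poly_comp[OF ring_map_at_y])
  also have "\<dots> = at_z (vals fs) p"
    unfolding at_z_def
    by (rule eval_poly_cong[OF assms]) (auto simp: z_vars_def at_y_def eval_poly_Const[OF ring_map_id])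
  finally show ?thesis .
qed

lemma ideal_I_eq: "ideal_I K \<alpha> = {p \<in> Ky. at_y \<alpha> p = 0}"
  by (auto simp: ideal_I_def a_kernel_def')

lemma Ky_subset_Kyz: "Ky \<subseteq> Kyz fs" and Kz_subset_Kyz: "Kz fs \<subseteq> Kyz fs"
  by (intro polys_mono; blast)+

lemma ideal_Lhat_gens:
  assumes "set fs \<subseteq> Ky"
  shows "ideal_I K \<alpha> \<union> {Var (Z i) - fs ! i | i. i < length fs} \<subseteq> {p \<in> Kyz fs. eval_yz fs p = 0}"
proof -
  note S = is_subring_polys[OF K, of "y_vars (length \<alpha>) \<union> z_vars (length fs)"]
  have "Var (Z i) - fs ! i \<in> {p \<in> Kyz fs. eval_yz fs p = 0}" if "i < length fs" for i
  proof -
    have fi: "fs ! i \<in> Ky" using assms that by auto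
    have "Var (Z i) \<in> Kyz fs" by (rule Var_in_polys[OF K]) (use that in \<open>auto simp: z_vars_def\<close>)
    moreover have "eval_yz fs (Var (Z i)) = at_y \<alpha> (fs ! i)"
      by (simp add: eval_yz_def eval_poly_Var[OF ring_map_id])
    ultimately show ?thesis
      using fi Ky_subset_Kyz[of fs] eval_yz_at_y[OF fi, of fs]
      by (auto simp: ring_map_simps[OF ring_map_eval_yz] intro!: is_subringD(6)[OF S])
  qed
  moreover have "ideal_I K \<alpha> \<subseteq> {p \<in> Kyz fs. eval_yz fs p = 0}"
    using Ky_subset_Kyz[of fs] eval_yz_at_y[of _ fs] by (auto simp: ideal_I_eq)
  ultimately show ?thesis by blast
qed

text \<open>Modulo the elements \<open>z\<^sub>i - f\<^sub>i\<close> the indeterminates \<open>z\<^sub>i\<close> can be eliminated, and a polynomial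
  in \<open>y\<^sub>1,\<dots>,y\<^sub>n\<close> whose value is zero lies in \<open>I\<close>. Hence the generators account for the
  whole kernel.\<close>

lemma ideal_Lhat_eq:
  assumes fs: "set fs \<subseteq> Ky"
  shows "ideal_Lhat K \<alpha> fs = {p \<in> Kyz fs. eval_yz fs p = 0}"
proof -
  let ?S = "Kyz fs"
  let ?G = "ideal_I K \<alpha> \<union> {Var (Z i) - fs ! i | i. i < length fs}"
  note S = is_subring_polys[OF K, of "y_vars (length \<alpha>) \<union> z_vars (length fs)"]
  have gens: "?G \<subseteq> ?S" using ideal_Lhat_gens[OF fs] by blast
  then have L: "ideal_Lhat K \<alpha> fs = ideal_span ?S ?G"
    unfolding ideal_Lhat_def by (rule genideal_eq_ideal_span[OF S])
  have "ideal_span ?S ?G \<subseteq> ?S" by (rule ideal_span_subset[OF S gens])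
  moreover have "eval_yz fs p = 0" if "p \<in> ideal_span ?S ?G" for p
    using that
  proof induction
    case (add c x y)
    have "eval_yz fs x = 0" using ideal_Lhat_gens[OF fs] add.hyps(2) by blast
    then show ?case using add.IH by (simp add: ring_map_simps[OF ring_map_eval_yz])
  qed (simp add: ring_map_simps[OF ring_map_eval_yz])
  moreover have "p \<in> ideal_span ?S ?G" if p: "p \<in> ?S" "eval_yz fs p = 0" for p
  proof -
    define \<tau> where "\<tau> = eval_poly Const (\<lambda>v. case v of Y i \<Rightarrow> Var (Y i) | Z i \<Rightarrow> fs ! i)"
    have \<tau>: "ring_map \<tau>" unfolding \<tau>_def by (intro ring_map_eval_poly ring_map_Const)
    have \<tau>K: "\<tau> q \<in> Ky" if "q \<in> ?S" for q
      unfolding \<tau>_def using fs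
      by (intro eval_poly_in_subring[OF is_subring_polys[OF K] that])
        (auto simp: y_vars_def z_vars_def intro!: Const_in_polys[OF K] Var_in_polys[OF K])
    have \<tau>e: "eval_yz fs (\<tau> q) = eval_yz fs q" if "q \<in> ?S" for q
    proof -
      have "eval_yz fs (\<tau> q) = eval_poly (\<lambda>c. eval_yz fs (Const c))
          (\<lambda>v. eval_yz fs (case v of Y i \<Rightarrow> Var (Y i) | Z i \<Rightarrow> fs ! i)) q"
        unfolding \<tau>_def by (rule eval_poly_comp[OF ring_map_eval_yz])
      also have "\<dots> = eval_yz fs q"
        unfolding eval_yz_def[where fs = fs, THEN fun_cong, where x = q]
      proof (rule eval_poly_cong[OF that])
        fix v assume "v \<in> y_vars (length \<alpha>) \<union> z_vars (length fs)"
        then show "eval_yz fs (case v of Y i \<Rightarrow> Var (Y i) | Z i \<Rightarrow> fs ! i) =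
            (case v of Y i \<Rightarrow> \<alpha> ! i | Z i \<Rightarrow> at_y \<alpha> (fs ! i))"
          using fs eval_yz_at_y[OF subsetD[OF fs nth_mem]]
          by (auto simp: y_vars_def z_vars_def eval_yz_def eval_poly_Var[OF ring_map_id])
      qed (simp add: eval_yz_def eval_poly_Const[OF ring_map_id])
      finally show ?thesis .
    qed
    \<comment> \<open>Modulo the generators, every polynomial is congruent to its image under \<open>z\<^sub>i \<mapsto> f\<^sub>i\<close>:
      the polynomials with this property form a subring that contains \<open>K\<close> and the indeterminates.\<close>
    have "?S \<subseteq> {q \<in> ?S. q - \<tau> q \<in> ideal_span ?S ?G}" (is "_ \<subseteq> ?T")
    proof (rule polys_subset_subring)
      have \<tau>S: "\<tau> q \<in> ?S" if "q \<in> ?S" for q using \<tau>K[OF that] Ky_subset_Kyz[of fs] by blast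
      show "is_subring ?T"
      proof (rule is_subringI)
        show "1 \<in> ?T" by (simp add: ring_map_simps[OF \<tau>] ideal_span.zero is_subringD[OF S])
      next
        fix x assume "x \<in> ?T"
        then have "x \<in> ?S" "- x - \<tau> (- x) \<in> ideal_span ?S ?G"
          using ideal_span_diff[OF S ideal_span.zero, of "x - \<tau> x" ?G] by (auto simp: ring_map_simps[OF \<tau>])
        then show "- x \<in> ?T" by (simp add: is_subringD[OF S])
      next
        fix x y assume xy: "x \<in> ?T" "y \<in> ?T"
        have eq: "x + y - \<tau> (x + y) = (x - \<tau> x) + (y - \<tau> y)" by (simp add: ring_map_simps[OF \<tau>])
        show "x + y \<in> ?T"
          unfolding mem_Collect_eq eq using xy by (intro conjI is_subringD(5)[OF S] ideal_span_plus) auto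
        have "x * y - \<tau> (x * y) = y * (x - \<tau> x) + \<tau> x * (y - \<tau> y)"
          by (simp add: ring_map_simps[OF \<tau>] algebra_simps)
        then show "x * y \<in> ?T"
          using xy \<tau>S[of x] by (auto simp: is_subringD[OF S] intro!: ideal_span_plus ideal_span_scale[OF S])
      qed
      show "Const ` K \<subseteq> ?T"
        by (auto simp: \<tau>_def eval_poly_Const[OF ring_map_Const] ideal_span.zero Const_in_polys[OF K])
      show "Var ` (y_vars (length \<alpha>) \<union> z_vars (length fs)) \<subseteq> ?T"
      proof (rule image_subsetI)
        fix v assume v: "v \<in> y_vars (length \<alpha>) \<union> z_vars (length fs)"
        then have "Var v - \<tau> (Var v) \<in> insert 0 ?G"
          by (auto simp: \<tau>_def eval_poly_Var[OF ring_map_Const] y_vars_def z_vars_def)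
        then have "Var v - \<tau> (Var v) \<in> ideal_span ?S ?G"
          by (rule insertE) (simp only: ideal_span.zero, rule ideal_span_base[OF S])
        then show "Var v \<in> ?T" using Var_in_polys[OF K v] by simp
      qed
    qed
    then have "p - \<tau> p \<in> ideal_span ?S ?G" using p(1) by blast
    moreover have "\<tau> p \<in> ideal_I K \<alpha>"
      using \<tau>K[OF p(1)] \<tau>e[OF p(1)] eval_yz_at_y[OF \<tau>K[OF p(1)], of fs] p(2) by (simp add: ideal_I_eq)
    then have "\<tau> p \<in> ideal_span ?S ?G" by (intro ideal_span_base[OF S]) auto
    ultimately have "(p - \<tau> p) + \<tau> p \<in> ideal_span ?S ?G" by (rule ideal_span_plus)
    then show ?thesis by simp
  qed
  ultimately show ?thesis unfolding L by blast
qed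

lemma ideal_J_eq:
  assumes fs: "set fs \<subseteq> Ky"
  shows "ideal_J K \<alpha> fs = {p \<in> Kz fs. at_z (vals fs) p = 0}"
  unfolding ideal_J_def ideal_Lhat_eq[OF fs] using Kz_subset_Kyz[of fs] eval_yz_at_z[of _ fs] by auto

lemma eval_yz_image:
  assumes fs: "set fs \<subseteq> Ky" shows "eval_yz fs ` Kyz fs = at_y \<alpha> ` Ky"
proof -
  have "at_y \<alpha> ` set fs \<subseteq> at_y \<alpha> ` Ky" using fs by blast
  then have *: "at_y \<alpha> ` set fs \<subseteq> subalg K (set \<alpha>)" by (simp add: at_y_image[OF K])
  have "(\<lambda>v. case v of Y i \<Rightarrow> \<alpha> ! i | Z i \<Rightarrow> at_y \<alpha> (fs ! i)) ` (y_vars (length \<alpha>) \<union> z_vars (length fs))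
      = set \<alpha> \<union> at_y \<alpha> ` set fs"
    by (simp add: y_vars_def z_vars_def image_Un image_image image_nth_lessThan
        image_image[of "at_y \<alpha>" "(!) fs", symmetric])
  then have "eval_yz fs ` Kyz fs = subalg K (set \<alpha> \<union> at_y \<alpha> ` set fs)"
    unfolding eval_yz_def eval_poly_image[OF K] by simp
  also have "\<dots> = subalg K (set \<alpha>)"
    using * subalg_incl[of K "set \<alpha>"]
    by (intro equalityI subalg_subset[OF is_subring_subalg] subalg_mono) auto
  finally show ?thesis by (simp add: at_y_image[OF K])
qed

text \<open>\<open>M\<close> describes the elements of the current algebra that are multiples of \<open>a\<close> in \<open>R\<close>, whereas
  \<open>N\<close> (\<open>ideal_N_eq\<close>) describes those that are multiples of \<open>a\<close> in the current algebra.\<close>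

lemma ideal_M_eq:
  assumes fs: "set fs \<subseteq> Ky" and g: "g \<in> Kz fs"
  shows "ideal_M K \<alpha> fs g = {p \<in> Kz fs. \<exists>r\<in>subalg K (set \<alpha>). at_z (vals fs) p = at_z (vals fs) g * r}"
proof -
  note S = is_subring_polys[OF K, of "y_vars (length \<alpha>) \<union> z_vars (length fs)"]
  have g': "g \<in> Kyz fs" using g Kz_subset_Kyz[of fs] by blast
  have "ideal_Mhat K \<alpha> fs g = ideal_span (Kyz fs) (insert g {x \<in> Kyz fs. eval_yz fs x = 0})"
    unfolding ideal_Mhat_def ideal_Lhat_eq[OF fs] by (rule genideal_eq_ideal_span[OF S]) (use g' in auto)
  then have "ideal_Mhat K \<alpha> fs g = {p \<in> Kyz fs. \<exists>r\<in>eval_yz fs ` Kyz fs. eval_yz fs p = eval_yz fs g * r}"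
    by (simp add: ideal_span_insert_kernel[OF S ring_map_eval_yz g'])
  then show ?thesis
    unfolding ideal_M_def eval_yz_image[OF fs] at_y_image[OF K]
    using Kz_subset_Kyz[of fs] eval_yz_at_z[of _ fs] g by auto
qed

lemma ideal_N_eq:
  assumes fs: "set fs \<subseteq> Ky" and g: "g \<in> Kz fs"
  shows "ideal_N K \<alpha> fs g =
    {p \<in> Kz fs. \<exists>r\<in>subalg K (at_y \<alpha> ` set fs). at_z (vals fs) p = at_z (vals fs) g * r}"
proof -
  note S = is_subring_polys[OF K, of "z_vars (length fs)"]
  have "ideal_N K \<alpha> fs g = ideal_span (Kz fs) (insert g {x \<in> Kz fs. at_z (vals fs) x = 0})"
    unfolding ideal_N_def ideal_J_eq[OF fs] by (rule genideal_eq_ideal_span[OF S]) (use g in auto)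
  then have "ideal_N K \<alpha> fs g = {p \<in> Kz fs. \<exists>r\<in>at_z (vals fs) ` Kz fs. at_z (vals fs) p = at_z (vals fs) g * r}"
    by (simp add: ideal_span_insert_kernel[OF S ring_map_at_z g])
  then have "ideal_N K \<alpha> fs g =
      {p \<in> Kz fs. \<exists>r\<in>at_z (vals fs) ` polys K (z_vars (length (vals fs))). at_z (vals fs) p = at_z (vals fs) g * r}"
    by simp
  then show ?thesis unfolding at_z_image[OF K] by simp
qed

lemma ideal_J'_span:
  assumes fs: "set fs \<subseteq> Ky" and g: "g \<in> Kz fs"
  shows "ideal_J' K \<alpha> fs g = ideal_span Ky (insert (subst_z fs g) (ideal_I K \<alpha>))"
  unfolding ideal_J'_def
  by (rule genideal_eq_ideal_span[OF is_subring_polys[OF K]])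
    (use subst_z_in_polys[OF K fs g] in \<open>auto simp: ideal_I_eq\<close>)

lemma ideal_J'_eq:
  assumes fs: "set fs \<subseteq> Ky" and g: "g \<in> Kz fs"
  shows "ideal_J' K \<alpha> fs g = {p \<in> Ky. \<exists>r\<in>subalg K (set \<alpha>). at_y \<alpha> p = at_z (vals fs) g * r}"
  unfolding ideal_J'_span[OF fs g] ideal_I_eq at_y_image[OF K, symmetric]
  by (simp add: ideal_span_insert_kernel[OF is_subring_polys[OF K] ring_map_at_y subst_z_in_polys[OF K fs g]]
      at_y_subst_z[OF g])

lemma subst_z_in_ideal_J':
  assumes fs: "set fs \<subseteq> Ky" and g: "g \<in> Kz fs" and h: "h \<in> ideal_M K \<alpha> fs g"
  shows "subst_z fs h \<in> ideal_J' K \<alpha> fs g"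
  using h subst_z_in_polys[OF K fs, of h] at_y_subst_z[of h fs]
  by (auto simp: ideal_M_eq[OF fs g] ideal_J'_eq[OF fs g])

end

section \<open>Monomial orders and reduction\<close>

lemma monomials_add: "s \<in> monomials V \<Longrightarrow> t \<in> monomials V \<Longrightarrow> s + t \<in> monomials V"
  using keys_add[of s t] by (auto simp: monomials_def)

lemma zero_in_monomials: "0 \<in> monomials V"
  by (simp add: monomials_def)

text \<open>The lexicographic order with respect to the indices of the \<open>y\<^sub>i\<close>; the indeterminates themselves
  carry no order.\<close>

lemma monomial_order_exists: "\<exists>ord. monomial_order (y_vars n) ord"
proof -
  define \<kappa> :: "monomial \<Rightarrow> nat \<Rightarrow>\<^sub>0 nat" where "\<kappa> = Poly_Mapping.map_key Y"
  have Y: "inj Y" by (simp add: inj_def)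
  have lookup: "Poly_Mapping.lookup (\<kappa> t) i = Poly_Mapping.lookup t (Y i)" for t i
    unfolding \<kappa>_def using Y by (simp add: map_key.rep_eq)
  have add: "\<kappa> (s + t) = \<kappa> s + \<kappa> t" for s t
    by (rule poly_mapping_eqI) (simp add: lookup lookup_add)
  have inj: "s = t" if "s \<in> monomials (y_vars n)" "t \<in> monomials (y_vars n)" "\<kappa> s = \<kappa> t" for s t
  proof (rule poly_mapping_eqI)
    fix v
    show "Poly_Mapping.lookup s v = Poly_Mapping.lookup t v"
    proof (cases v)
      case (Y i)
      then show ?thesis using lookup[of s i] lookup[of t i] that(3) by simp
    next
      case (Z i)
      then have "v \<notin> Poly_Mapping.keys s" "v \<notin> Poly_Mapping.keys t"
        using that(1,2) by (auto simp: monomials_def y_vars_def)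
      then show ?thesis by (simp add: in_keys_iff)
    qed
  qed
  have nonneg: "0 \<le> u" for u :: "nat \<Rightarrow>\<^sub>0 nat"
  proof (rule ccontr)
    assume "\<not> 0 \<le> u"
    then have "u < 0" by simp
    then have "less_fun (Poly_Mapping.lookup u) (\<lambda>_. 0)" by transfer
    then show False by (auto simp: less_fun_def)
  qed
  let ?M = "monomials (y_vars n)"
  let ?ord = "{(s, t). s \<in> ?M \<and> t \<in> ?M \<and> \<kappa> s \<le> \<kappa> t}"
  have "linear_order_on ?M ?ord"
    unfolding linear_order_on_def partial_order_on_def preorder_on_def
    by (auto simp: refl_on_def trans_def antisym_def total_on_def dest: inj)
  moreover have "\<forall>t\<in>?M. (0, t) \<in> ?ord"
    using nonneg by (auto simp: zero_in_monomials \<kappa>_def map_key_zero[OF Y])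
  moreover have "\<forall>s\<in>?M. \<forall>t\<in>?M. \<forall>u\<in>?M. (s, t) \<in> ?ord \<longrightarrow> (s + u, t + u) \<in> ?ord"
    by (auto simp: monomials_add add add_right_mono)
  ultimately show ?thesis unfolding monomial_order_def by (intro exI[of _ ?ord] conjI)
qed

text \<open>That \<open>1 \<noteq> 0\<close> is demanded because a monomial is recovered from the polynomial with coefficient
  \<open>1\<close>, which would be zero in the trivial ring.\<close>

locale reduction_setting =
  fixes K :: "'a::comm_ring_1 set" and V :: "indet set" and ord :: "monomial rel"
  assumes K: "is_subring K" and noeth: "noetherian_on (polys K V)" and order: "monomial_order V ord"
    and nontrivial: "(1::'a) \<noteq> 0"
begin

lemma ord_refl: "t \<in> monomials V \<Longrightarrow> (t, t) \<in> ord"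
  and ord_trans: "(s, t) \<in> ord \<Longrightarrow> (t, u) \<in> ord \<Longrightarrow> (s, u) \<in> ord"
  and ord_antisym: "(s, t) \<in> ord \<Longrightarrow> (t, s) \<in> ord \<Longrightarrow> s = t"
  and ord_total: "s \<in> monomials V \<Longrightarrow> t \<in> monomials V \<Longrightarrow> (s, t) \<in> ord \<or> (t, s) \<in> ord"
  and ord_zero: "t \<in> monomials V \<Longrightarrow> (0, t) \<in> ord"
  and ord_add: "s \<in> monomials V \<Longrightarrow> t \<in> monomials V \<Longrightarrow> u \<in> monomials V \<Longrightarrow> (s, t) \<in> ord \<Longrightarrow> (s + u, t + u) \<in> ord"
proof -
  have lin: "refl_on (monomials V) ord" "trans ord" "antisym ord" "total_on (monomials V) ord"
    using order by (auto simp: monomial_order_def linear_order_on_def partial_order_on_def preorder_on_def)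
  show "t \<in> monomials V \<Longrightarrow> (t, t) \<in> ord" using lin(1) by (rule refl_onD)
  show "(s, t) \<in> ord \<Longrightarrow> (t, u) \<in> ord \<Longrightarrow> (s, u) \<in> ord" using lin(2) by (rule transD)
  show "(s, t) \<in> ord \<Longrightarrow> (t, s) \<in> ord \<Longrightarrow> s = t" using lin(3) by (rule antisymD)
  show "s \<in> monomials V \<Longrightarrow> t \<in> monomials V \<Longrightarrow> (s, t) \<in> ord \<or> (t, s) \<in> ord"
    using lin(1,4) unfolding total_on_def refl_on_def by (cases "s = t") auto
qed (use order in \<open>auto simp: monomial_order_def\<close>)

lemma finite_extremum:
  assumes "finite A" "A \<noteq> {}" "A \<subseteq> monomials V"
  shows "\<exists>m\<in>A. \<forall>t\<in>A. (m, t) \<in> ord" "\<exists>m\<in>A. \<forall>t\<in>A. (t, m) \<in> ord"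
proof -
  have "(\<exists>m\<in>A. \<forall>t\<in>A. (m, t) \<in> ord) \<and> (\<exists>m\<in>A. \<forall>t\<in>A. (t, m) \<in> ord)"
    using assms
  proof (induction rule: finite_ne_induct)
    case (singleton x)
    then show ?case using ord_refl by auto
  next
    case (insert x A)
    then obtain l m where lm: "l \<in> A" "\<forall>t\<in>A. (l, t) \<in> ord" "m \<in> A" "\<forall>t\<in>A. (t, m) \<in> ord" by auto
    have x: "x \<in> monomials V" "l \<in> monomials V" "m \<in> monomials V" using insert lm by auto
    have "\<exists>m\<in>insert x A. \<forall>t\<in>insert x A. (m, t) \<in> ord"
      using ord_total[OF x(1,2)]
    proof
      assume "(x, l) \<in> ord"
      then show ?thesis using lm(2) ord_refl[OF x(1)] by (intro bexI[of _ x]) (auto intro: ord_trans)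
    next
      assume "(l, x) \<in> ord"
      then show ?thesis using lm(1,2) by (intro bexI[of _ l]) auto
    qed
    moreover have "\<exists>m\<in>insert x A. \<forall>t\<in>insert x A. (t, m) \<in> ord"
      using ord_total[OF x(1,3)]
    proof
      assume "(m, x) \<in> ord"
      then show ?thesis using lm(4) ord_refl[OF x(1)] by (intro bexI[of _ x]) (auto intro: ord_trans)
    next
      assume "(x, m) \<in> ord"
      then show ?thesis using lm(3,4) by (intro bexI[of _ m]) auto
    qed
    ultimately show ?case by blast
  qed
  then show "\<exists>m\<in>A. \<forall>t\<in>A. (m, t) \<in> ord" "\<exists>m\<in>A. \<forall>t\<in>A. (t, m) \<in> ord" by auto
qed

text \<open>Monomial orders are well-orders. By the basis theorem, finitely many monomials of \<open>A\<close> divide all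
  the others, and a divisor is never larger than its multiple; so a minimum of these finitely many
  monomials is a minimum of \<open>A\<close>.\<close>

lemma ord_minimum:
  assumes A: "A \<subseteq> monomials V" "A \<noteq> {}"
  shows "\<exists>m\<in>A. \<forall>t\<in>A. (m, t) \<in> ord"
proof -
  let ?x = "\<lambda>t. Poly_Mapping.single t (1::'a)"
  note S = is_subring_polys[OF K, of V]
  have "?x ` A \<subseteq> polys K V" using A(1) K by (auto intro!: single_in_polys simp: is_subringD)
  from noeth[unfolded noetherian_on_def, rule_format, OF this]
  obtain F where F: "F \<subseteq> ?x ` A" "finite F" "?x ` A \<subseteq> ideal_span (polys K V) F" by blast
  obtain B where B: "B \<subseteq> A" "finite B" "F = ?x ` B" using finite_subset_image[OF F(2,1)] by blast
  have dvd: "\<forall>t\<in>Poly_Mapping.keys p. \<exists>b\<in>B. \<exists>u\<in>monomials V. t = u + b"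
    if "p \<in> ideal_span (polys K V) F" for p
    using that
  proof induction
    case (add c x y)
    then obtain b where b: "b \<in> B" "x = ?x b" using B(3) by blast
    have "Poly_Mapping.keys (c * x) \<subseteq> {u + b | u. u \<in> Poly_Mapping.keys c}"
      using keys_mult[of c x] b(2) nontrivial by auto
    moreover have "Poly_Mapping.keys c \<subseteq> monomials V" using add(1) by (auto simp: polys_def)
    ultimately show ?case using add.IH b(1) keys_add[of "c * x" y] by blast
  qed simp
  have *: "\<exists>b\<in>B. (b, t) \<in> ord" if "t \<in> A" for t
  proof -
    have "?x t \<in> ideal_span (polys K V) F" using F(3) that by blast
    from dvd[OF this] obtain b u where bu: "b \<in> B" "u \<in> monomials V" "t = u + b"
      using nontrivial by auto
    have "(0 + b, u + b) \<in> ord" using bu A(1) B(1) by (intro ord_add ord_zero zero_in_monomials) auto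
    then show ?thesis using bu by auto
  qed
  then have "B \<noteq> {}" using A(2) by blast
  from finite_extremum(1)[OF B(2) this] B(1) A(1) obtain m where m: "m \<in> B" "\<forall>b\<in>B. (m, b) \<in> ord" by blast
  have "\<forall>t\<in>A. (m, t) \<in> ord" using * m(2) ord_trans by blast
  then show ?thesis using m(1) B(1) by blast
qed

lemma lead_mon:
  assumes "p \<in> polys K V" "p \<noteq> 0"
  shows "lead_mon ord p \<in> Poly_Mapping.keys p" "\<And>s. s \<in> Poly_Mapping.keys p \<Longrightarrow> (s, lead_mon ord p) \<in> ord"
proof -
  have "Poly_Mapping.keys p \<subseteq> monomials V" "Poly_Mapping.keys p \<noteq> {}"
    using assms by (auto simp: polys_def)
  from finite_extremum(2)[OF finite_keys this(2,1)]
  obtain m where m: "m \<in> Poly_Mapping.keys p" "\<forall>t\<in>Poly_Mapping.keys p. (t, m) \<in> ord" by blast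
  have "lead_mon ord p \<in> Poly_Mapping.keys p \<and> (\<forall>s\<in>Poly_Mapping.keys p. (s, lead_mon ord p) \<in> ord)"
    unfolding lead_mon_def by (rule theI[of _ m]) (use m ord_antisym in auto)
  then show "lead_mon ord p \<in> Poly_Mapping.keys p"
    "\<And>s. s \<in> Poly_Mapping.keys p \<Longrightarrow> (s, lead_mon ord p) \<in> ord" by auto
qed

lemma lead_mon_in_monomials: "p \<in> polys K V \<Longrightarrow> p \<noteq> 0 \<Longrightarrow> lead_mon ord p \<in> monomials V"
  using lead_mon(1)[of p] by (auto simp: polys_def)

lemma lead_term_in_polys: "p \<in> polys K V \<Longrightarrow> p \<noteq> 0 \<Longrightarrow> lead_term ord p \<in> polys K V"
  unfolding lead_term_def
  by (intro single_in_polys[OF K] lead_mon_in_monomials) (simp_all add: in_polys_iff)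

lemma lead_terms_in_polys: "J \<subseteq> polys K V \<Longrightarrow> lead_term ord ` (J - {0}) \<subseteq> polys K V"
  by (rule image_subsetI, rule lead_term_in_polys) blast+

lemma groebner_basis_exists:
  assumes J: "J \<subseteq> polys K V"
  shows "\<exists>gb. groebner_basis K V ord gb J"
proof -
  note S = is_subring_polys[OF K, of V]
  let ?A = "lead_term ord ` (J - {0})"
  note A = lead_terms_in_polys[OF J]
  obtain F where F: "F \<subseteq> ?A" "finite F" "?A \<subseteq> ideal_span (polys K V) F"
    using noeth[unfolded noetherian_on_def, rule_format, OF A] by blast
  obtain B where B: "B \<subseteq> J - {0}" "finite B" "F = lead_term ord ` B"
    using finite_subset_image[OF F(2,1)] by blast
  from finite_list[OF B(2)] obtain gb where gb: "set gb = B" by blast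
  have "ideal_span (polys K V) F = ideal_span (polys K V) ?A"
    by (intro equalityI ideal_span_minimal[OF S F(3)] ideal_span_mono[OF S F(1)])
  moreover have "F \<subseteq> polys K V" using F(1) A by (rule subset_trans)
  ultimately have "genideal (ring_on (polys K V)) F = genideal (ring_on (polys K V)) ?A"
    using genideal_eq_ideal_span[OF S] A by simp
  then show ?thesis unfolding groebner_basis_def using B gb by (intro exI[of _ gb]) auto
qed

lemma reduces_by_decreases:
  assumes gb: "set gb \<subseteq> polys K V - {0}" and p: "p \<in> polys K V" and red: "reduces_by K V ord gb p ws"
  shows "p - dot ws gb \<in> polys K V"
    and "p - dot ws gb \<noteq> 0 \<Longrightarrow> (lead_mon ord (p - dot ws gb), lead_mon ord p) \<in> ord \<and>
      lead_mon ord (p - dot ws gb) \<noteq> lead_mon ord p"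
proof -
  note S = is_subring_polys[OF K, of V]
  have len: "length ws = length gb" and p0: "p \<noteq> 0" using red by (auto simp: reduces_by_def)
  have wsj: "ws ! j \<in> polys K V" "\<And>t. t \<in> Poly_Mapping.keys (ws ! j) \<Longrightarrow> t + lead_mon ord (gb ! j) = lead_mon ord p"
    if "j < length gb" for j using red that by (auto simp: reduces_by_def)
  have gbj: "gb ! j \<in> polys K V" "gb ! j \<noteq> 0" if "j < length gb" for j using gb that nth_mem[of j gb] by blast+
  have "dot ws gb \<in> polys K V" unfolding dot_def using wsj gbj len
    by (auto intro!: is_subring_sum[OF S] is_subringD(4)[OF S])
  then show q: "p - dot ws gb \<in> polys K V" using p by (simp add: is_subringD[OF S])
  define tail where "tail j = gb ! j - lead_term ord (gb ! j)" for j
  \<comment> \<open>After the leading terms have cancelled, only products with the tails of the basis elements are left.\<close>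
  have eq: "p - dot ws gb = (p - lead_term ord p) - (\<Sum>j<length gb. ws ! j * tail j)"
    using red len by (simp add: reduces_by_def dot_def tail_def right_diff_distrib sum_subtractf)
  have sub: "Poly_Mapping.keys (p - dot ws gb) \<subseteq>
      Poly_Mapping.keys (p - lead_term ord p) \<union> (\<Union>j<length gb. Poly_Mapping.keys (ws ! j * tail j))"
    unfolding eq using keys_diff[of "p - lead_term ord p" "\<Sum>j<length gb. ws ! j * tail j"]
      keys_sum[of "\<lambda>j. ws ! j * tail j" "{..<length gb}"] by blast
  have tail_keys: "Poly_Mapping.keys (r - lead_term ord r) \<subseteq> Poly_Mapping.keys r - {lead_mon ord r}" for r :: "'a mpol"
    by (auto simp: in_keys_iff lookup_minus lead_term_def lookup_single when_def split: if_splits)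
  have less: "(s, lead_mon ord p) \<in> ord \<and> s \<noteq> lead_mon ord p" if "s \<in> Poly_Mapping.keys (p - dot ws gb)" for s
  proof -
    from that sub consider "s \<in> Poly_Mapping.keys (p - lead_term ord p)"
      | j where "j < length gb" "s \<in> Poly_Mapping.keys (ws ! j * tail j)" by blast
    then show ?thesis
    proof cases
      case 1
      then show ?thesis using tail_keys[of p] lead_mon(2)[OF p p0] by blast
    next
      case 2
      then obtain t u where tu: "t \<in> Poly_Mapping.keys (ws ! j)" "u \<in> Poly_Mapping.keys (tail j)" "s = t + u"
        using keys_mult[of "ws ! j" "tail j"] by blast
      have u: "u \<in> Poly_Mapping.keys (gb ! j)" "u \<noteq> lead_mon ord (gb ! j)"
        using tail_keys[of "gb ! j"] tu(2) by (auto simp: tail_def)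
      have mons: "t \<in> monomials V" "u \<in> monomials V" "lead_mon ord (gb ! j) \<in> monomials V"
        using wsj(1)[OF 2(1)] gbj[OF 2(1)] tu(1) u(1) lead_mon_in_monomials by (auto simp: polys_def)
      have "(u + t, lead_mon ord (gb ! j) + t) \<in> ord"
        by (intro ord_add mons lead_mon(2)[OF gbj[OF 2(1)]] u)
      moreover have "s = u + t" "lead_mon ord p = lead_mon ord (gb ! j) + t"
        using tu(3) wsj(2)[OF 2(1) tu(1)] by (simp_all add: add.commute)
      ultimately show ?thesis using u(2) by simp
    qed
  qed
  show "p - dot ws gb \<noteq> 0 \<Longrightarrow> (lead_mon ord (p - dot ws gb), lead_mon ord p) \<in> ord \<and>
      lead_mon ord (p - dot ws gb) \<noteq> lead_mon ord p"
    using less[OF lead_mon(1)[OF q]] .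
qed

lemma reduction_invariant:
  assumes gb: "set gb \<subseteq> polys K V - {0}" and p: "p \<in> polys K V" and red: "reduction K V ord gb p us q"
  shows "length us = length gb \<and> set us \<subseteq> polys K V \<and> q \<in> polys K V \<and> p = dot us gb + q"
  using red
proof induction
  case start
  then show ?case using p is_subringD(1)[OF is_subring_polys[OF K]] by (auto simp: dot_def)
next
  case (step us q ws)
  note S = is_subring_polys[OF K, of V]
  have ws: "length ws = length gb" "set ws \<subseteq> polys K V"
    using step.hyps(2) by (auto simp: reduces_by_def in_set_conv_nth)
  have "set (map2 (+) us ws) \<subseteq> polys K V"
  proof
    fix x assume "x \<in> set (map2 (+) us ws)"
    then obtain u w where "x = u + w" "u \<in> set us" "w \<in> set ws"
      by (auto dest: set_zip_leftD set_zip_rightD)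
    then show "x \<in> polys K V" using step.IH ws(2) is_subringD(5)[OF S] by blast
  qed
  moreover have "dot (map2 (+) us ws) gb = dot us gb + dot ws gb"
    using step.IH ws by (simp add: dot_def distrib_right sum.distrib)
  ultimately show ?case
    using step.IH ws reduces_by_decreases(1)[OF gb _ step.hyps(2)] by simp
qed

text \<open>Among the polynomials that can be reached by reduction, zero or one with minimal leading monomial
  cannot be reduced further, since a reduction step would lower the leading monomial.\<close>

lemma complete_reduction_exists:
  assumes gb: "set gb \<subseteq> polys K V - {0}" and p: "p \<in> polys K V"
  shows "\<exists>us q. complete_reduction K V ord gb p us q"
proof (cases "\<exists>us. reduction K V ord gb p us 0")
  case True
  then show ?thesis by (auto simp: complete_reduction_def reduces_by_def)
next
  case False
  let ?Q = "{q. \<exists>us. reduction K V ord gb p us q}"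
  have Q: "q \<in> polys K V \<and> q \<noteq> 0" if "q \<in> ?Q" for q
    using that False reduction_invariant[OF gb p] by auto
  have "p \<in> ?Q" using reduction.start by blast
  then have "lead_mon ord ` ?Q \<noteq> {}" by blast
  moreover have "lead_mon ord ` ?Q \<subseteq> monomials V" using Q lead_mon_in_monomials by blast
  ultimately obtain q where q: "q \<in> ?Q" "\<forall>r\<in>?Q. (lead_mon ord q, lead_mon ord r) \<in> ord"
    using ord_minimum[of "lead_mon ord ` ?Q"] by blast
  then obtain us where us: "reduction K V ord gb p us q" by blast
  have "\<not> reduces_by K V ord gb q ws" for ws
  proof
    assume red: "reduces_by K V ord gb q ws"
    then have r: "q - dot ws gb \<in> ?Q" using reduction.step[OF us] by blast
    have "(lead_mon ord (q - dot ws gb), lead_mon ord q) \<in> ord \<and> lead_mon ord (q - dot ws gb) \<noteq> lead_mon ord q"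
      using reduces_by_decreases(2)[OF gb _ red] Q[OF q(1)] Q[OF r] by blast
    then show False using q(2) r ord_antisym by blast
  qed
  then show ?thesis using us unfolding complete_reduction_def by blast
qed

text \<open>The leading term of \<open>p\<close> is some combination of leading terms of basis elements. Comparing
  coefficients of the leading monomial turns it into a combination with terms as coefficients,
  as a reduction step requires.\<close>

lemma groebner_basis_reduces:
  assumes J: "J \<subseteq> polys K V" and gb: "groebner_basis K V ord gb J" and p: "p \<in> J" "p \<noteq> 0"
  shows "\<exists>ws. reduces_by K V ord gb p ws"
proof -
  note S = is_subring_polys[OF K, of V]
  have gbJ: "set gb \<subseteq> J - {0}" using gb by (simp add: groebner_basis_def)
  have pV: "p \<in> polys K V" using p J by blast
  let ?m = "lead_mon ord p"
  note LJ = lead_terms_in_polys[OF J]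
  then have Lgb: "set (map (lead_term ord) gb) \<subseteq> polys K V" using gbJ by auto
  have "lead_term ord p \<in> ideal_span (polys K V) (lead_term ord ` (J - {0}))"
    using p by (intro ideal_span_base[OF S]) auto
  then have "lead_term ord p \<in> ideal_span (polys K V) (set (map (lead_term ord) gb))"
    using gb genideal_eq_ideal_span[OF S LJ] genideal_eq_ideal_span[OF S Lgb] by (simp add: groebner_basis_def)
  then obtain cs where cs: "length cs = length gb" "set cs \<subseteq> polys K V"
    "lead_term ord p = dot cs (map (lead_term ord) gb)"
    unfolding ideal_span_set_list[OF S] by auto
  \<comment> \<open>Keep of each coefficient only the term that contributes to the monomial \<open>?m\<close>.\<close>
  define w where "w j = (if \<exists>t. t + lead_mon ord (gb ! j) = ?m
     then Poly_Mapping.single (?m - lead_mon ord (gb ! j)) (Poly_Mapping.lookup (cs ! j) (?m - lead_mon ord (gb ! j)))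
     else 0)" for j
  have part: "w j * lead_term ord (gb ! j) =
      Poly_Mapping.single ?m (Poly_Mapping.lookup (cs ! j * lead_term ord (gb ! j)) ?m)" for j
  proof -
    let ?l = "lead_mon ord (gb ! j)"
    let ?b = "Poly_Mapping.lookup (gb ! j) ?l"
    have lookup: "Poly_Mapping.lookup (cs ! j * lead_term ord (gb ! j)) ?m =
        (\<Sum>t\<in>Poly_Mapping.keys (cs ! j). if t + ?l = ?m then Poly_Mapping.lookup (cs ! j) t * ?b else 0)"
    proof -
      have "cs ! j * lead_term ord (gb ! j) =
          (\<Sum>t\<in>Poly_Mapping.keys (cs ! j). Poly_Mapping.single (t + ?l) (Poly_Mapping.lookup (cs ! j) t * ?b))"
        by (subst (1) sum_single_keys[of "cs ! j", symmetric])
          (simp add: lead_term_def sum_distrib_right mult_single)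
      then show ?thesis by (simp add: lookup_sum lookup_single when_def)
    qed
    show ?thesis
    proof (cases "\<exists>t. t + ?l = ?m")
      case True
      then obtain t where t: "t + ?l = ?m" by blast
      have m: "?m - ?l = t" unfolding t[symmetric] by simp
      have "s + ?l = ?m \<longleftrightarrow> s = t" for s unfolding t[symmetric] by simp
      then have "Poly_Mapping.lookup (cs ! j * lead_term ord (gb ! j)) ?m = Poly_Mapping.lookup (cs ! j) t * ?b"
        unfolding lookup by (simp add: in_keys_iff)
      moreover have "w j * lead_term ord (gb ! j) = Poly_Mapping.single ?m (Poly_Mapping.lookup (cs ! j) t * ?b)"
        using True by (simp add: w_def m lead_term_def mult_single t)
      ultimately show ?thesis by simp
    next
      case False
      then show ?thesis by (simp add: lookup w_def)
    qed
  qed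
  have "lead_term ord p = Poly_Mapping.single ?m (Poly_Mapping.lookup (dot cs (map (lead_term ord) gb)) ?m)"
    using cs(3) by (metis lead_term_def lookup_single_eq)
  also have "\<dots> = (\<Sum>j<length gb. w j * lead_term ord (gb ! j))"
  proof -
    have single_sum: "Poly_Mapping.single ?m (sum f A) = (\<Sum>i\<in>A. Poly_Mapping.single ?m (f i))"
      for f :: "nat \<Rightarrow> 'a" and A
      by (induction A rule: infinite_finite_induct) (simp_all add: single_add)
    show ?thesis unfolding part dot_def using cs(1) by (simp add: lookup_sum single_sum)
  qed
  finally have "lead_term ord p = (\<Sum>j<length gb. w j * lead_term ord (gb ! j))" .
  moreover have "w j \<in> polys K V" if j: "j < length gb" for j
  proof (cases "\<exists>t. t + lead_mon ord (gb ! j) = ?m")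
    case True
    then obtain t where t: "t + lead_mon ord (gb ! j) = ?m" by blast
    then have t': "?m - lead_mon ord (gb ! j) = t" by (metis add_diff_cancel_right')
    have "Poly_Mapping.keys t \<subseteq> Poly_Mapping.keys ?m"
      unfolding t[symmetric] by (auto simp: in_keys_iff lookup_add)
    then have "t \<in> monomials V" using lead_mon_in_monomials[OF pV p(2)] by (auto simp: monomials_def)
    moreover have "cs ! j \<in> polys K V" using cs(1,2) j nth_mem[of j cs] by auto
    ultimately show ?thesis using True t' by (auto simp: w_def in_polys_iff[of "cs ! j"] intro!: single_in_polys[OF K])
  qed (simp add: w_def is_subringD[OF S])
  moreover have "t + lead_mon ord (gb ! j) = ?m" if "t \<in> Poly_Mapping.keys (w j)" for t j
    using that by (auto simp: w_def split: if_splits) (metis add_diff_cancel_right')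
  ultimately have "reduces_by K V ord gb p (map w [0..<length gb])"
    unfolding reduces_by_def using p(2) by auto
  then show ?thesis by blast
qed

end

section \<open>Correctness and termination\<close>

lemma dot_append_last:
  "length cs = Suc (length xs) \<Longrightarrow> dot cs (xs @ [g]) = (\<Sum>k<length xs. cs ! k * xs ! k) + last cs * g"
  by (simp add: dot_def nth_append last_conv_nth[of cs] flip: length_0_conv)

text \<open>What the procedure needs to know about the ring \<open>Inv\<close> of invariants: it is an intermediate ring
  that is closed under division by \<open>a\<close> within \<open>R\<close>, and each of its elements is carried into \<open>B\<close>
  by some power of \<open>a\<close>.\<close>

locale invariant_procedure = generated_algebra K \<alpha> for K :: "'l::field set" and \<alpha> +
  fixes Inv B :: "'l set" and Ib :: "'l mpol list" and a :: 'l
  assumes noeth: "noetherian_on K"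
    and Inv: "is_subring Inv" "K \<subseteq> Inv" "Inv \<subseteq> subalg K (set \<alpha>)"
    and Inv_div: "\<And>x. x \<in> subalg K (set \<alpha>) \<Longrightarrow> a * x \<in> Inv \<Longrightarrow> x \<in> Inv"
    and a: "a \<in> B" "a \<noteq> 0" and B: "B \<subseteq> Inv"
    and clear_denominator: "\<And>x. x \<in> Inv \<Longrightarrow> \<exists>k. a ^ k * x \<in> B"
    and Ib: "set Ib \<subseteq> ideal_I K \<alpha>" "ideal_I K \<alpha> = ideal_span (polys K (y_vars (length \<alpha>))) (set Ib)"
begin

abbreviation "R \<equiv> subalg K (set \<alpha>)"

definition alg :: "'l mpol list \<Rightarrow> 'l set" where
  "alg fs = subalg K (at_y \<alpha> ` set fs)"

definition admissible :: "'l mpol list \<Rightarrow> bool" where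
  "admissible fs \<longleftrightarrow> set fs \<subseteq> Ky \<and> B \<subseteq> alg fs \<and> alg fs \<subseteq> Inv"

definition represents_a :: "'l mpol list \<Rightarrow> 'l mpol \<Rightarrow> bool" where
  "represents_a fs g \<longleftrightarrow> admissible fs \<and> g \<in> Kz fs \<and> at_z (vals fs) g = a"

definition generates_M :: "'l mpol list \<Rightarrow> 'l mpol \<Rightarrow> 'l mpol list \<Rightarrow> bool" where
  "generates_M fs g hs \<longleftrightarrow> represents_a fs g \<and> set hs \<subseteq> ideal_M K \<alpha> fs g \<and>
     genideal (ring_on (Kz fs)) (ideal_N K \<alpha> fs g \<union> set hs) = ideal_M K \<alpha> fs g"

definition divided_by_a :: "'l mpol list \<Rightarrow> 'l mpol \<Rightarrow> 'l mpol list \<Rightarrow> 'l mpol list \<Rightarrow> 'l mpol list \<Rightarrow> bool" where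
  "divided_by_a fs g hs rems new \<longleftrightarrow> length rems = length hs \<and> length new = length hs \<and>
     (\<forall>i<length hs. rems ! i = 0 \<and> new ! i \<in> Ky \<and>
        at_z (vals fs) g * at_y \<alpha> (new ! i) = at_z (vals fs) (hs ! i))"

definition represented_basis :: "'l mpol list \<Rightarrow> 'l mpol \<Rightarrow> 'l mpol list \<Rightarrow> 'l mpol list list \<Rightarrow> bool" where
  "represented_basis fs g gb reps \<longleftrightarrow> length reps = length gb \<and>
     (\<forall>j<length gb. length (reps ! j) = Suc (length Ib) \<and> set (reps ! j) \<subseteq> Ky \<and>
        gb ! j = dot (reps ! j) (Ib @ [subst_z fs g]))"

text \<open>In \<open>At_4\<close> and later, \<open>g\<close> always represents the same element \<open>a\<close>, although the polynomial \<open>g\<close> is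
  chosen anew in each round. The equation for \<open>At_8\<close> expresses that step (7) has divided by \<open>a\<close>,
  the one for \<open>Returned\<close> partial correctness.\<close>

fun invariant :: "'l state \<Rightarrow> bool" where
  "invariant (At_2 fs) \<longleftrightarrow> admissible fs"
| "invariant (At_3 fs) \<longleftrightarrow> admissible fs"
| "invariant (At_4 fs g) \<longleftrightarrow> represents_a fs g"
| "invariant (At_6 fs g) \<longleftrightarrow> represents_a fs g"
| "invariant (At_6b fs g hs ord) \<longleftrightarrow> generates_M fs g hs \<and> monomial_order (y_vars (length \<alpha>)) ord"
| "invariant (At_7 fs g hs ord gb reps) \<longleftrightarrow> generates_M fs g hs \<and> monomial_order (y_vars (length \<alpha>)) ord \<and>
     groebner_basis K (y_vars (length \<alpha>)) ord gb (ideal_J' K \<alpha> fs g) \<and> represented_basis fs g gb reps"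
| "invariant (At_8 fs g hs rems new) \<longleftrightarrow> generates_M fs g hs \<and> divided_by_a fs g hs rems new"
| "invariant (Returned bs J) \<longleftrightarrow> subalg K (set bs) = Inv \<and> J = relation_ideal K bs"

lemma is_subring_alg: "is_subring (alg fs)"
  unfolding alg_def by (rule is_subring_subalg)

lemma at_z_vals_image: "at_z (vals fs) ` Kz fs = alg fs"
  using at_z_image[OF K, of "vals fs"] by (simp add: alg_def)

lemma at_z_vals_in_alg: "p \<in> Kz fs \<Longrightarrow> at_z (vals fs) p \<in> alg fs"
  using at_z_vals_image by blast

lemma at_y_in_R: "p \<in> Ky \<Longrightarrow> at_y \<alpha> p \<in> R"
  using at_y_image[OF K, of \<alpha>] by blast

lemma relation_ideal_vals: "set fs \<subseteq> Ky \<Longrightarrow> relation_ideal K (vals fs) = ideal_J K \<alpha> fs"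
  by (simp add: ideal_J_eq relation_ideal_def a_kernel_def')

lemma reduction_setting_y:
  "monomial_order (y_vars (length \<alpha>)) ord \<Longrightarrow> reduction_setting K (y_vars (length \<alpha>)) ord"
  by (intro reduction_setting.intro K noetherian_on_polys noeth) (simp_all add: y_vars_def)

text \<open>The stopping criterion is exact. \<open>M \<subseteq> N\<close> says that the current algebra is closed under division
  by \<open>a\<close> within \<open>R\<close>. If so, an invariant \<open>x\<close> belongs to it, because \<open>a\<^sup>k x\<close> does for some \<open>k\<close> and the
  factors \<open>a\<close> can be removed one after the other. Conversely, the ring of all invariants is closed
  under this division.\<close>

lemma alg_eq_Inv_iff:
  assumes g: "represents_a fs g"
  shows "ideal_M K \<alpha> fs g \<subseteq> ideal_N K \<alpha> fs g \<longleftrightarrow> alg fs = Inv"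
proof -
  have fs: "set fs \<subseteq> Ky" "B \<subseteq> alg fs" "alg fs \<subseteq> Inv" and gz: "g \<in> Kz fs" "at_z (vals fs) g = a"
    using g by (auto simp: represents_a_def admissible_def)
  note M = ideal_M_eq[OF fs(1) gz(1), unfolded gz(2)]
  note N = ideal_N_eq[OF fs(1) gz(1), unfolded gz(2), folded alg_def]
  have aInv: "a \<in> Inv" using a(1) B by blast
  show ?thesis
  proof
    assume MN: "ideal_M K \<alpha> fs g \<subseteq> ideal_N K \<alpha> fs g"
    have div: "x \<in> alg fs" if x: "x \<in> R" "a * x \<in> alg fs" for x
    proof -
      from x(2) obtain p where p: "p \<in> Kz fs" "at_z (vals fs) p = a * x"
        using at_z_vals_image[of fs] by (metis imageE)
      then have "p \<in> ideal_N K \<alpha> fs g" using MN x(1) unfolding M by blast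
      then obtain r where "r \<in> alg fs" "a * x = a * r" unfolding N using p(2) by auto
      then show ?thesis using a(2) by simp
    qed
    have "x \<in> alg fs" if "x \<in> Inv" "a ^ k * x \<in> alg fs" for k x
      using that
    proof (induction k arbitrary: x)
      case (Suc k)
      have "a * x \<in> Inv" by (intro is_subringD(4)[OF Inv(1)] aInv Suc.prems)
      with Suc have "a * x \<in> alg fs" by (simp add: mult_ac)
      then show ?case using div Suc.prems(1) Inv(3) by blast
    qed simp
    then show "alg fs = Inv" using fs clear_denominator by blast
  next
    assume "alg fs = Inv"
    show "ideal_M K \<alpha> fs g \<subseteq> ideal_N K \<alpha> fs g"
    proof
      fix p assume "p \<in> ideal_M K \<alpha> fs g"
      then obtain r where r: "p \<in> Kz fs" "r \<in> R" "at_z (vals fs) p = a * r" unfolding M by blast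
      then have "r \<in> alg fs" using Inv_div[OF r(2)] at_z_vals_in_alg[OF r(1)] \<open>alg fs = Inv\<close> by simp
      then show "p \<in> ideal_N K \<alpha> fs g" unfolding N using r by blast
    qed
  qed
qed

lemma invariant_return:
  assumes "represents_a fs g" "ideal_M K \<alpha> fs g \<subseteq> ideal_N K \<alpha> fs g"
  shows "invariant (Returned (vals fs) (ideal_J K \<alpha> fs))"
  using alg_eq_Inv_iff[OF assms(1)] assms
  by (simp add: alg_def relation_ideal_vals represents_a_def admissible_def)

lemma represents_aD:
  assumes "represents_a fs g"
  shows "set fs \<subseteq> Ky" "g \<in> Kz fs" "at_z (vals fs) g = a" "alg fs \<subseteq> Inv" "B \<subseteq> alg fs"
  using assms by (auto simp: represents_a_def admissible_def)

lemma ideal_J'_subset: "represents_a fs g \<Longrightarrow> ideal_J' K \<alpha> fs g \<subseteq> Ky"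
  by (auto simp: ideal_J'_eq represents_aD)

text \<open>The polynomial \<open>h\<^sub>i(f\<^sub>1,\<dots>,f\<^sub>m)\<close> and the Groebner basis lie in the ideal \<open>J'\<close>, hence so does the
  remainder, which must then be zero as it is irreducible.\<close>

lemma divided_by_a_reduction:
  assumes M: "generates_M fs g hs" and ord: "monomial_order (y_vars (length \<alpha>)) ord"
    and gb: "groebner_basis K (y_vars (length \<alpha>)) ord gb (ideal_J' K \<alpha> fs g)"
    and reps: "represented_basis fs g gb reps"
    and len: "length rems = length hs" "length new = length hs"
    and red: "\<And>i. i < length hs \<Longrightarrow>
      complete_reduction K (y_vars (length \<alpha>)) ord gb (subst_z fs (hs ! i)) (us ! i) (rems ! i)"
    and new: "\<And>i. i < length hs \<Longrightarrow> new ! i = dot (us ! i) (map last reps)"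
  shows "divided_by_a fs g hs rems new"
  unfolding divided_by_a_def
proof (intro conjI allI impI len)
  interpret reduction_setting K "y_vars (length \<alpha>)" ord by (rule reduction_setting_y[OF ord])
  note S = is_subring_polys[OF K, of "y_vars (length \<alpha>)"]
  have a_g: "represents_a fs g" and hsM: "set hs \<subseteq> ideal_M K \<alpha> fs g"
    using M by (auto simp: generates_M_def)
  note g = represents_aD[OF a_g]
  let ?J = "ideal_J' K \<alpha> fs g"
  have gbJ: "set gb \<subseteq> ?J - {0}" using gb by (simp add: groebner_basis_def)
  have gbKy: "set gb \<subseteq> Ky - {0}" using gbJ ideal_J'_subset[OF a_g] by blast
  fix i assume i: "i < length hs"
  let ?p = "subst_z fs (hs ! i)"
  have h: "hs ! i \<in> ideal_M K \<alpha> fs g" using hsM i by auto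
  have pJ: "?p \<in> ?J" by (rule subst_z_in_ideal_J'[OF g(1,2) h])
  then have pKy: "?p \<in> Ky" using ideal_J'_subset[OF a_g] by blast
  have "reduction K (y_vars (length \<alpha>)) ord gb ?p (us ! i) (rems ! i)"
    using red[OF i] by (simp add: complete_reduction_def)
  from reduction_invariant[OF gbKy pKy this]
  have us: "length (us ! i) = length gb" "set (us ! i) \<subseteq> Ky" "?p = dot (us ! i) gb + rems ! i" by auto
  have usj: "us ! i ! j \<in> Ky" if "j < length gb" for j using us(1,2) that nth_mem[of j "us ! i"] by auto
  have "dot (us ! i) gb \<in> ?J"
    unfolding ideal_J'_span[OF g(1,2)] dot_def
  proof (intro ideal_span_sum ideal_span_scale[OF S])
    fix j assume "j \<in> {..<length (us ! i)}"
    then have j: "j < length gb" using us(1) by simp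
    show "us ! i ! j \<in> Ky" by (rule usj[OF j])
    show "gb ! j \<in> ideal_span Ky (insert (subst_z fs g) (ideal_I K \<alpha>))"
      using gbJ nth_mem[OF j] unfolding ideal_J'_span[OF g(1,2)] by blast
  qed
  moreover have "rems ! i = ?p - dot (us ! i) gb" using us(3) by simp
  ultimately have "rems ! i \<in> ?J" using pJ ideal_span_diff[OF S] unfolding ideal_J'_span[OF g(1,2)] by simp
  then show rem: "rems ! i = 0"
    using groebner_basis_reduces[OF ideal_J'_subset[OF a_g] gb] red[OF i]
    unfolding complete_reduction_def by blast
  have repsj: "length (reps ! j) = Suc (length Ib)" "set (reps ! j) \<subseteq> Ky" "last (reps ! j) \<in> Ky"
    "gb ! j = dot (reps ! j) (Ib @ [subst_z fs g])" if "j < length gb" for j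
  proof -
    show *: "length (reps ! j) = Suc (length Ib)" "set (reps ! j) \<subseteq> Ky"
      "gb ! j = dot (reps ! j) (Ib @ [subst_z fs g])"
      using reps that by (auto simp: represented_basis_def)
    then have "reps ! j \<noteq> []" by auto
    then show "last (reps ! j) \<in> Ky" using *(2) last_in_set by blast
  qed
  have lreps: "length reps = length gb" using reps by (simp add: represented_basis_def)
  note hom = ring_map_simps[OF ring_map_at_y[of \<alpha>]] ring_map_sum[OF ring_map_at_y[of \<alpha>]]
  \<comment> \<open>The basis of \<open>I\<close> vanishes at \<open>\<alpha>\<close>, so that only the coefficient of \<open>g(f\<^sub>1,\<dots>,f\<^sub>m)\<close> survives.\<close>
  have at_gb: "at_y \<alpha> (gb ! j) = a * at_y \<alpha> (last (reps ! j))" if j: "j < length gb" for j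
  proof -
    have "at_y \<alpha> (Ib ! k) = 0" if "k < length Ib" for k
      using Ib(1) nth_mem[OF that] unfolding ideal_I_eq by blast
    then show ?thesis
      unfolding repsj(4)[OF j] dot_append_last[OF repsj(1)[OF j]]
      using at_y_subst_z[OF g(2)] g(3) by (simp add: hom mult.commute)
  qed
  show "new ! i \<in> Ky"
    unfolding new[OF i] dot_def
  proof (intro is_subring_sum[OF S] is_subringD(4)[OF S])
    fix j assume "j \<in> {..<length (us ! i)}"
    then have j: "j < length gb" using us(1) by simp
    show "us ! i ! j \<in> Ky" by (rule usj[OF j])
    show "map last reps ! j \<in> Ky" using repsj(3)[OF j] j lreps by simp
  qed
  have "hs ! i \<in> Kz fs" using h by (simp add: ideal_M_def)
  then have "at_z (vals fs) (hs ! i) = at_y \<alpha> (dot (us ! i) gb)"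
    using at_y_subst_z[of "hs ! i" fs] us(3) rem by simp
  also have "\<dots> = (\<Sum>j<length gb. at_y \<alpha> (us ! i ! j) * (a * at_y \<alpha> (last (reps ! j))))"
    unfolding dot_def us(1) by (simp add: hom at_gb)
  also have "\<dots> = a * at_y \<alpha> (new ! i)"
    unfolding new[OF i] dot_def us(1) using lreps by (simp add: hom sum_distrib_left mult_ac)
  finally show "at_z (vals fs) g * at_y \<alpha> (new ! i) = at_z (vals fs) (hs ! i)" using g(3) by simp
qed

lemma ideal_N_subset: "represents_a fs g \<Longrightarrow> ideal_N K \<alpha> fs g \<subseteq> Kz fs"
  by (auto simp: ideal_N_eq represents_aD)

lemma at_y_new_in_Inv:
  assumes M: "generates_M fs g hs" and new: "divided_by_a fs g hs rems new" and i: "i < length hs"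
  shows "at_y \<alpha> (new ! i) \<in> Inv"
proof (rule Inv_div)
  have g: "represents_a fs g" using M by (simp add: generates_M_def)
  show "at_y \<alpha> (new ! i) \<in> R" using new i by (auto simp: divided_by_a_def intro: at_y_in_R)
  have "hs ! i \<in> Kz fs" using M i nth_mem[OF i] by (auto simp: generates_M_def ideal_M_def)
  then have "at_z (vals fs) (hs ! i) \<in> Inv" using at_z_vals_in_alg represents_aD(4)[OF g] by blast
  then show "a * at_y \<alpha> (new ! i) \<in> Inv"
    using new i represents_aD(3)[OF g] by (auto simp: divided_by_a_def)
qed

text \<open>One round adjoins all quotients \<open>x \<in> R\<close> of elements of the current algebra by \<open>a\<close>.
  Indeed \<open>a x\<close> is the value of an element of \<open>M\<close>, thus of a combination of \<open>N\<close>, whose values are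
  divisible by \<open>a\<close> already in the current algebra, and of the \<open>h\<^sub>i\<close>, whose quotients have just been added.\<close>

lemma alg_append:
  assumes M: "generates_M fs g hs" and new: "divided_by_a fs g hs rems new"
  shows "admissible (fs @ new)" "alg fs \<subseteq> alg (fs @ new)"
    "\<And>x. x \<in> R \<Longrightarrow> a * x \<in> alg fs \<Longrightarrow> x \<in> alg (fs @ new)"
proof -
  have a_g: "represents_a fs g" and hsM: "set hs \<subseteq> ideal_M K \<alpha> fs g"
    and gen: "genideal (ring_on (Kz fs)) (ideal_N K \<alpha> fs g \<union> set hs) = ideal_M K \<alpha> fs g"
    using M by (auto simp: generates_M_def)
  note g = represents_aD[OF a_g]
  show mono: "alg fs \<subseteq> alg (fs @ new)" unfolding alg_def by (rule subalg_mono) auto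
  have newI: "at_y \<alpha> p \<in> Inv \<and> p \<in> Ky" if "p \<in> set new" for p
  proof -
    from that obtain i where "i < length new" "p = new ! i" by (auto simp: in_set_conv_nth)
    then show ?thesis using at_y_new_in_Inv[OF M new, of i] new by (simp add: divided_by_a_def)
  qed
  have "at_y \<alpha> ` set fs \<subseteq> alg fs" unfolding alg_def using subalg_incl[of K "at_y \<alpha> ` set fs"] by blast
  then have "at_y \<alpha> ` set (fs @ new) \<subseteq> Inv" using g(4) newI by auto
  then have "alg (fs @ new) \<subseteq> Inv" unfolding alg_def by (rule subalg_subset[OF Inv(1,2)])
  then show "admissible (fs @ new)" using g mono newI by (auto simp: admissible_def)
  note S = is_subring_polys[OF K, of "z_vars (length fs)"]
  let ?A = "ideal_N K \<alpha> fs g \<union> set hs"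
  have A: "?A \<subseteq> Kz fs" using ideal_N_subset[OF a_g] hsM by (auto simp: ideal_M_def)
  have quot: "\<exists>r\<in>alg (fs @ new). at_z (vals fs) p = a * r" if "p \<in> ideal_span (Kz fs) ?A" for p
    using that
  proof induction
    case zero
    then show ?case using is_subringD(1)[OF is_subring_alg]
      by (auto simp: ring_map_simps[OF ring_map_at_z] intro!: bexI[of _ 0])
  next
    case (add c x y)
    then obtain r where r: "r \<in> alg (fs @ new)" "at_z (vals fs) y = a * r" by blast
    have "\<exists>s\<in>alg (fs @ new). at_z (vals fs) x = a * s"
    proof (cases "x \<in> set hs")
      case True
      then obtain i where i: "i < length hs" "x = hs ! i" by (auto simp: in_set_conv_nth)
      have "new ! i \<in> set (fs @ new)" using new i by (auto simp: divided_by_a_def)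
      then have "at_y \<alpha> (new ! i) \<in> alg (fs @ new)"
        unfolding alg_def using subalg_incl[of K "at_y \<alpha> ` set (fs @ new)"] by blast
      moreover have "at_z (vals fs) x = a * at_y \<alpha> (new ! i)"
        using new i g(3) by (simp add: divided_by_a_def)
      ultimately show ?thesis by blast
    next
      case False
      then show ?thesis using add.hyps(2) mono ideal_N_eq[OF g(1,2)] g(3) by (auto simp: alg_def)
    qed
    then obtain s where s: "s \<in> alg (fs @ new)" "at_z (vals fs) x = a * s" by blast
    have "at_z (vals fs) c \<in> alg (fs @ new)" using at_z_vals_in_alg[OF add.hyps(1)] mono by blast
    then have "at_z (vals fs) c * s + r \<in> alg (fs @ new)"
      by (intro is_subringD(4,5)[OF is_subring_alg] r s)
    moreover have "at_z (vals fs) (c * x + y) = a * (at_z (vals fs) c * s + r)"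
      using r s by (simp add: ring_map_simps[OF ring_map_at_z] algebra_simps)
    ultimately show ?case by blast
  qed
  fix x assume x: "x \<in> R" "a * x \<in> alg fs"
  then obtain p where p: "p \<in> Kz fs" "at_z (vals fs) p = a * x"
    using at_z_vals_image[of fs] by (metis imageE)
  then have "p \<in> ideal_M K \<alpha> fs g" using x(1) g(3) unfolding ideal_M_eq[OF g(1,2)] by auto
  then have "p \<in> ideal_span (Kz fs) ?A" using gen genideal_eq_ideal_span[OF S A] by simp
  from quot[OF this] p(2) a(2) show "x \<in> alg (fs @ new)" by auto
qed

lemma invariant_step: "step K \<alpha> Ib a s s' \<Longrightarrow> invariant s \<Longrightarrow> invariant s'"
proof (induction rule: step.induct)
  case (substitute fs' fs)
  then show ?case by (simp add: admissible_def alg_def)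
next
  case (return fs g)
  then show ?case using invariant_return by simp
next
  case (reduce us hs rems new ord gb fs reps g)
  then show ?case by (auto intro!: divided_by_a_reduction)
next
  case (repeat fs g hs rems new)
  then show ?case by (auto intro: alg_append(1))
qed (auto simp: represents_a_def generates_M_def represented_basis_def)

lemma invariant_reachable: "reachable K \<alpha> Ib a fs s \<Longrightarrow> admissible fs \<Longrightarrow> invariant s"
  by (induction rule: rtranclp_induct) (auto intro: invariant_step)

lemma represents_a_exists:
  assumes "admissible fs" shows "\<exists>g. represents_a fs g"
proof -
  have "a \<in> at_z (vals fs) ` Kz fs" using assms a(1) at_z_vals_image[of fs] by (auto simp: admissible_def)
  then obtain g where "a = at_z (vals fs) g" "g \<in> Kz fs" by (rule imageE)
  with assms have "represents_a fs g" unfolding represents_a_def by (intro conjI) (simp_all only:)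
  then show ?thesis by blast
qed

text \<open>Finitely many \<open>h\<^sub>i\<close> suffice because \<open>K[z\<^sub>1,\<dots>,z\<^sub>m]\<close> is Noetherian; that \<open>M\<close> is an ideal
  follows from its description by values.\<close>

lemma generates_M_exists:
  assumes a_g: "represents_a fs g" shows "\<exists>hs. generates_M fs g hs"
proof -
  note g = represents_aD[OF a_g]
  note S = is_subring_polys[OF K, of "z_vars (length fs)"]
  let ?M = "ideal_M K \<alpha> fs g" and ?N = "ideal_N K \<alpha> fs g"
  note M = ideal_M_eq[OF g(1,2)]
  have "noetherian_on (Kz fs)" by (intro noetherian_on_polys K noeth) (simp add: z_vars_def)
  moreover have MKz: "?M \<subseteq> Kz fs" by (auto simp: ideal_M_def)
  ultimately have "\<exists>F\<subseteq>?M. finite F \<and> ?M \<subseteq> ideal_span (Kz fs) F" by (simp add: noetherian_on_def)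
  then obtain F where F: "F \<subseteq> ?M" "finite F" "?M \<subseteq> ideal_span (Kz fs) F" by blast
  from finite_list[OF F(2)] obtain hs where hs: "set hs = F" by blast
  have algR: "alg fs \<subseteq> R" using g(4) Inv(3) by blast
  have ideal: "p \<in> ?M" if "p \<in> ideal_span (Kz fs) ?M" for p
    using that
  proof induction
    case zero
    then show ?case unfolding M using is_subringD(1)[OF S] is_subringD(1)[OF is_subring_subalg, of K "set \<alpha>"]
      by (auto simp: ring_map_simps[OF ring_map_at_z] intro!: bexI[of _ 0])
  next
    case (add c x y)
    then obtain r s where *: "x \<in> Kz fs" "y \<in> Kz fs" "r \<in> R" "s \<in> R"
      "at_z (vals fs) x = at_z (vals fs) g * r" "at_z (vals fs) y = at_z (vals fs) g * s"
      unfolding M by blast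
    have "c * x + y \<in> Kz fs" by (intro is_subringD(4,5)[OF S] * add.hyps(1))
    moreover have "at_z (vals fs) c * r + s \<in> R"
      using at_z_vals_in_alg[OF add.hyps(1)] algR
      by (intro is_subringD(4,5)[OF is_subring_subalg] *) blast
    moreover have "at_z (vals fs) (c * x + y) = at_z (vals fs) g * (at_z (vals fs) c * r + s)"
      using * by (simp add: ring_map_simps[OF ring_map_at_z] algebra_simps)
    ultimately show ?case unfolding M by blast
  qed
  have "?N \<subseteq> ?M" unfolding M ideal_N_eq[OF g(1,2)] using algR by (auto simp: alg_def)
  then have NF: "?N \<union> F \<subseteq> ?M" using F(1) by blast
  then have "genideal (ring_on (Kz fs)) (?N \<union> F) = ideal_span (Kz fs) (?N \<union> F)"
    using MKz by (intro genideal_eq_ideal_span[OF S]) blast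
  also have "\<dots> = ?M"
    using ideal_span_mono[OF S NF] ideal F(3) ideal_span_mono[OF S, of F "?N \<union> F"] by blast
  finally show ?thesis using a_g F(1) hs by (auto simp: generates_M_def)
qed

lemma represented_basis_exists:
  assumes a_g: "represents_a fs g" and gb: "set gb \<subseteq> ideal_J' K \<alpha> fs g"
  shows "\<exists>reps. represented_basis fs g gb reps"
proof -
  note g = represents_aD[OF a_g]
  note S = is_subring_polys[OF K, of "y_vars (length \<alpha>)"]
  let ?xs = "Ib @ [subst_z fs g]"
  have "insert (subst_z fs g) (ideal_I K \<alpha>) \<subseteq> ideal_span Ky (set ?xs)"
    using ideal_span_base[OF S, of "subst_z fs g" "set ?xs"] ideal_span_mono[OF S, of "set Ib" "set ?xs"]
    unfolding Ib(2) by auto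
  then have "ideal_J' K \<alpha> fs g \<subseteq> ideal_span Ky (set ?xs)"
    unfolding ideal_J'_span[OF g(1,2)] by (rule ideal_span_minimal[OF S])
  then have "\<exists>cs. length cs = length ?xs \<and> set cs \<subseteq> Ky \<and> gb ! j = dot cs ?xs" if "j < length gb" for j
    using gb nth_mem[OF that] unfolding ideal_span_set_list[OF S] by blast
  then obtain r where "\<And>j. j < length gb \<Longrightarrow> length (r j) = length ?xs \<and> set (r j) \<subseteq> Ky \<and> gb ! j = dot (r j) ?xs"
    by metis
  then show ?thesis unfolding represented_basis_def by (intro exI[of _ "map r [0..<length gb]"]) auto
qed

lemma progress:
  assumes "invariant s" "\<not> returned s"
  shows "\<exists>s'. step K \<alpha> Ib a s s'"
proof (cases s)
  case (At_2 fs)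
  then have "step K \<alpha> Ib a s (At_3 fs)" using assms by (auto simp: admissible_def intro: step.substitute)
  then show ?thesis by blast
next
  case (At_3 fs)
  with assms obtain g where "represents_a fs g" using represents_a_exists[of fs] by auto
  then have "step K \<alpha> Ib a s (At_4 fs g)" using At_3 by (auto simp: represents_a_def intro: step.choose_g)
  then show ?thesis by blast
next
  case (At_4 fs g)
  then show ?thesis using step.return step.continue by metis
next
  case (At_6 fs g)
  then obtain hs where hs: "generates_M fs g hs" using generates_M_exists[of fs g] assms by auto
  obtain ord where "monomial_order (y_vars (length \<alpha>)) ord" using monomial_order_exists by blast
  with hs have "step K \<alpha> Ib a s (At_6b fs g hs ord)"
    using At_6 by (auto simp: generates_M_def intro: step.choose_h)
  then show ?thesis by blast
next
  case (At_6b fs g hs ord)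
  then have a_g: "represents_a fs g" and ord: "monomial_order (y_vars (length \<alpha>)) ord"
    using assms by (auto simp: generates_M_def)
  interpret reduction_setting K "y_vars (length \<alpha>)" ord by (rule reduction_setting_y[OF ord])
  obtain gb where gb: "groebner_basis K (y_vars (length \<alpha>)) ord gb (ideal_J' K \<alpha> fs g)"
    using groebner_basis_exists[OF ideal_J'_subset[OF a_g]] by blast
  then have "set gb \<subseteq> ideal_J' K \<alpha> fs g" by (auto simp: groebner_basis_def)
  then obtain reps where "represented_basis fs g gb reps" using represented_basis_exists[OF a_g] by blast
  then have "step K \<alpha> Ib a s (At_7 fs g hs ord gb reps)"
    unfolding At_6b by (intro step.groebner[OF gb]) (simp_all add: represented_basis_def)
  then show ?thesis by blast
next
  case (At_7 fs g hs ord gb reps)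
  then have M: "generates_M fs g hs" and a_g: "represents_a fs g"
    and ord: "monomial_order (y_vars (length \<alpha>)) ord"
    and gb: "groebner_basis K (y_vars (length \<alpha>)) ord gb (ideal_J' K \<alpha> fs g)"
    using assms by (auto simp: generates_M_def)
  interpret reduction_setting K "y_vars (length \<alpha>)" ord by (rule reduction_setting_y[OF ord])
  have gbKy: "set gb \<subseteq> Ky - {0}" using gb ideal_J'_subset[OF a_g] by (auto simp: groebner_basis_def)
  have "\<exists>us q. complete_reduction K (y_vars (length \<alpha>)) ord gb (subst_z fs (hs ! i)) us q" if "i < length hs" for i
  proof (rule complete_reduction_exists[OF gbKy])
    have "hs ! i \<in> ideal_M K \<alpha> fs g" using M nth_mem[OF that] by (auto simp: generates_M_def)
    then show "subst_z fs (hs ! i) \<in> Ky"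
      using subst_z_in_ideal_J'[OF represents_aD(1,2)[OF a_g]] ideal_J'_subset[OF a_g] by blast
  qed
  then obtain us q where "\<And>i. i < length hs \<Longrightarrow>
      complete_reduction K (y_vars (length \<alpha>)) ord gb (subst_z fs (hs ! i)) (us i) (q i)"
    by metis
  then have "step K \<alpha> Ib a s (At_8 fs g hs (map q [0..<length hs])
      (map (\<lambda>i. dot (us i) (map last reps)) [0..<length hs]))"
    unfolding At_7 by (intro step.reduce[where us = "map us [0..<length hs]"]) auto
  then show ?thesis by blast
next
  case (At_8 fs g hs rems new)
  then show ?thesis using step.repeat by blast
next
  case (Returned bs J)
  then show ?thesis using assms by (simp add: returned_def)
qed

inductive_cases step_At_2: "step K \<alpha> Ib a (At_2 fs) s"
inductive_cases step_At_3: "step K \<alpha> Ib a (At_3 fs) s"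
inductive_cases step_At_4: "step K \<alpha> Ib a (At_4 fs g) s"
inductive_cases step_At_6: "step K \<alpha> Ib a (At_6 fs g) s"
inductive_cases step_At_6b: "step K \<alpha> Ib a (At_6b fs g hs ord) s"
inductive_cases step_At_7: "step K \<alpha> Ib a (At_7 fs g hs ord gb reps) s"
inductive_cases step_At_8: "step K \<alpha> Ib a (At_8 fs g hs rems new) s"

text \<open>Seven steps lead from one visit of step (2) to the next one. Step (2) itself may change the
  generators but not the algebra.\<close>

lemma cycle:
  assumes steps: "\<And>t. step K \<alpha> Ib a (\<rho> t) (\<rho> (Suc t))" "\<And>t. invariant (\<rho> t)" "\<And>t. \<not> returned (\<rho> t)"
    and start: "\<rho> t = At_2 fs"
  shows "\<exists>fs'. \<rho> (t + 7) = At_2 fs' \<and> alg fs \<noteq> Inv \<and> alg fs \<subseteq> alg fs' \<and>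
    (\<forall>x\<in>R. a * x \<in> alg fs \<longrightarrow> x \<in> alg fs')"
proof -
  from steps(1)[of t] start obtain fs1 where 1: "\<rho> (t + 1) = At_3 fs1" "alg fs1 = alg fs"
    by (auto simp: alg_def elim: step_At_2)
  from steps(1)[of "t + 1"] 1 obtain g where 2: "\<rho> (t + 2) = At_4 fs1 g" by (auto elim: step_At_3)
  from steps(1)[of "t + 2"] 2 steps(3)[of "t + 3"]
  have 3: "\<rho> (t + 3) = At_6 fs1 g" "\<not> ideal_M K \<alpha> fs1 g \<subseteq> ideal_N K \<alpha> fs1 g"
    by (auto simp: returned_def numeral_eq_Suc elim: step_At_4)
  from steps(1)[of "t + 3"] 3 obtain hs ord where 4: "\<rho> (t + 4) = At_6b fs1 g hs ord"
    by (auto simp: numeral_eq_Suc elim: step_At_6)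
  from steps(1)[of "t + 4"] 4 obtain gb reps where 5: "\<rho> (t + 5) = At_7 fs1 g hs ord gb reps"
    by (auto simp: numeral_eq_Suc elim: step_At_6b)
  from steps(1)[of "t + 5"] 5 obtain rems new where 6: "\<rho> (t + 6) = At_8 fs1 g hs rems new"
    by (auto simp: numeral_eq_Suc elim: step_At_7)
  from steps(1)[of "t + 6"] 6 have 7: "\<rho> (t + 7) = At_2 (fs1 @ new)"
    by (auto simp: numeral_eq_Suc elim: step_At_8)
  have "alg fs \<noteq> Inv" using steps(2)[of "t + 2"] 2 3(2) alg_eq_Inv_iff[of fs1 g] 1(2) by simp
  moreover have "generates_M fs1 g hs" "divided_by_a fs1 g hs rems new" using steps(2)[of "t + 6"] 6 by auto
  from alg_append[OF this] have "alg fs \<subseteq> alg (fs1 @ new)" "\<forall>x\<in>R. a * x \<in> alg fs \<longrightarrow> x \<in> alg (fs1 @ new)"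
    using 1(2) by auto
  ultimately show ?thesis using 7 by blast
qed

lemma execution_reachable:
  assumes "execution K \<alpha> Ib a fs \<rho>" shows "reachable K \<alpha> Ib a fs (\<rho> t)"
proof (induction t)
  case 0
  then show ?case using assms by (simp add: execution_def)
next
  case (Suc t)
  then show ?case using assms unfolding execution_def by (metis rtranclp.rtrancl_into_rtrancl)
qed

text \<open>By \<open>alg_append\<close>, an invariant \<open>x\<close> with \<open>a\<^sup>k x \<in> B\<close> lies in the algebra after \<open>k\<close> rounds. If finitely
  many invariants generate, all of them are reached simultaneously after finitely many rounds; the
  algebra then equals the ring of invariants, and the criterion of step (5) stops the procedure.\<close>

lemma termination_if_finitely_generated:
  assumes adm: "admissible fs" and exec: "execution K \<alpha> Ib a fs \<rho>" and fg: "fin_gen_algebra K Inv"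
  shows "\<exists>t. returned (\<rho> t)"
proof (rule ccontr)
  assume never: "\<nexists>t. returned (\<rho> t)"
  then have steps: "\<And>t. step K \<alpha> Ib a (\<rho> t) (\<rho> (Suc t))" "\<And>t. invariant (\<rho> t)" "\<And>t. \<not> returned (\<rho> t)"
    using exec invariant_reachable[OF execution_reachable[OF exec] adm] unfolding execution_def by auto
  note cyc = cycle[of \<rho>, OF steps]
  have "\<exists>gs. \<rho> (7 * k) = At_2 gs" for k
  proof (induction k)
    case 0
    then show ?case using exec by (auto simp: execution_def)
  next
    case (Suc k)
    then obtain gs where "\<rho> (7 * k) = At_2 gs" by blast
    from cyc[OF this] show ?case by (auto simp: add.commute)
  qed
  then obtain f where f: "\<And>k. \<rho> (7 * k) = At_2 (f k)" by metis
  define A where "A k = alg (f k)" for k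
  have f0: "f 0 = fs" using f[of 0] exec by (simp add: execution_def)
  have A: "A k \<noteq> Inv \<and> A k \<subseteq> A (Suc k) \<and> (\<forall>x\<in>R. a * x \<in> A k \<longrightarrow> x \<in> A (Suc k))" for k
    using cyc[OF f[of k]] f[of "Suc k"] unfolding A_def by (auto simp: add.commute)
  have mono: "A k \<subseteq> A l" if "k \<le> l" for k l using A lift_Suc_mono_le[of A k l] that by blast
  have aInv: "a \<in> Inv" using a(1) B by blast
  have reach: "x \<in> A j" if "x \<in> Inv" "a ^ j * x \<in> A 0" for j x
    using that
  proof (induction j arbitrary: x)
    case (Suc j)
    have "a * x \<in> Inv" by (intro is_subringD(4)[OF Inv(1)] aInv Suc.prems)
    with Suc have "a * x \<in> A j" by (simp add: mult_ac)
    then show ?case using A[of j] Suc.prems(1) Inv(3) by blast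
  qed simp
  obtain S where S: "finite S" "Inv = subalg K S" using fg by (auto simp: fin_gen_algebra_def)
  have SI: "S \<subseteq> Inv" unfolding S(2) using subalg_incl[of K S] by blast
  from S(1) SI have "\<exists>n. S \<subseteq> A n"
  proof (induction rule: finite_induct)
    case (insert x S)
    then obtain n where n: "S \<subseteq> A n" by auto
    obtain j where "a ^ j * x \<in> B" using clear_denominator[of x] insert.prems by auto
    moreover have "B \<subseteq> A 0" using adm f0 by (simp add: admissible_def A_def)
    ultimately have "x \<in> A j" using reach[of x j] insert.prems by blast
    then have "insert x S \<subseteq> A (max n j)" using n mono[of n "max n j"] mono[of j "max n j"] by auto
    then show ?case by blast
  qed auto
  then obtain n where "S \<subseteq> A n" by blast
  then have "Inv \<subseteq> A n"
    unfolding S(2) A_def alg_def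
    by (intro subalg_subset[OF is_subring_subalg]) (use subalg_incl[of K "at_y \<alpha> ` set (f n)"] in auto)
  moreover have "A n \<subseteq> Inv" using steps(2)[of "7 * n"] f[of n] by (simp add: admissible_def A_def)
  ultimately show False using A by blast
qed

lemma returned_fin_gen:
  assumes "admissible fs" "execution K \<alpha> Ib a fs \<rho>" "returned (\<rho> t)"
  shows "fin_gen_algebra K Inv"
proof -
  obtain bs J where "\<rho> t = Returned bs J" using assms(3) by (auto simp: returned_def)
  then have "subalg K (set bs) = Inv" using invariant_reachable[OF execution_reachable[OF assms(2)] assms(1), of t] by simp
  then show ?thesis by (auto simp: fin_gen_algebra_def)
qed

end

section \<open>Invariants of group actions\<close>

lemma fixed_points_iff:
  assumes "acts_by_automorphisms G \<phi>"
  shows "x \<in> fixed_points G \<phi> S \<longleftrightarrow> x \<in> S \<and> (\<forall>\<sigma>\<in>carrier G. \<phi> \<sigma> x = x)"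
proof -
  have "group G" using assms unfolding acts_by_automorphisms_def group_action_def group_hom_def by blast
  then have "carrier G \<noteq> {}" using group.is_monoid monoid.one_closed by blast
  then show ?thesis by (auto simp: fixed_points_def invariants_def)
qed

lemma automorphism_simps:
  assumes "acts_by_automorphisms G \<phi>" "\<sigma> \<in> carrier G"
  shows "\<phi> \<sigma> (x + y) = \<phi> \<sigma> x + \<phi> \<sigma> y" "\<phi> \<sigma> (x * y) = \<phi> \<sigma> x * \<phi> \<sigma> y" "\<phi> \<sigma> 1 = 1" "\<phi> \<sigma> (- x) = - \<phi> \<sigma> x"
proof -
  have "\<phi> \<sigma> \<in> ring_hom (ring_on UNIV) (ring_on UNIV)"
    using assms by (auto simp: acts_by_automorphisms_def ring_iso_def)
  then show *: "\<phi> \<sigma> (x + y) = \<phi> \<sigma> x + \<phi> \<sigma> y" "\<phi> \<sigma> (x * y) = \<phi> \<sigma> x * \<phi> \<sigma> y" "\<phi> \<sigma> 1 = 1" for x y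
    by (simp_all add: ring_hom_def)
  have "\<phi> \<sigma> 0 + \<phi> \<sigma> 0 = \<phi> \<sigma> 0 + 0" using *(1)[of 0 0, symmetric] by (simp only: add_0_right)
  then have "\<phi> \<sigma> 0 = 0" by (simp only: add_left_cancel)
  then show "\<phi> \<sigma> (- x) = - \<phi> \<sigma> x" using *(1)[of x "- x"] by (simp add: minus_unique)
qed

lemma is_subring_fixed_points:
  assumes "acts_by_automorphisms G \<phi>" "is_subring R"
  shows "is_subring (fixed_points G \<phi> R)"
  by (rule is_subringI)
    (auto simp: fixed_points_iff[OF assms(1)] automorphism_simps[OF assms(1)] is_subringD[OF assms(2)])

lemma adjoin_inverse_clear:
  assumes B: "is_subring B" and a: "a \<in> B" "a \<noteq> 0" and x: "x \<in> adjoin_inverse B a"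
  shows "\<exists>k. a ^ k * x \<in> B"
proof -
  have "is_subring {x. \<exists>k. a ^ k * x \<in> B}"
  proof (rule is_subringI)
    show "1 \<in> {x. \<exists>k. a ^ k * x \<in> B}" using is_subringD(2)[OF B] by (auto intro: exI[of _ 0])
  next
    fix x y assume "x \<in> {x. \<exists>k. a ^ k * x \<in> B}" "y \<in> {x. \<exists>k. a ^ k * x \<in> B}"
    then obtain k l where kl: "a ^ k * x \<in> B" "a ^ l * y \<in> B" by blast
    have "a ^ (k + l) * (x * y) = (a ^ k * x) * (a ^ l * y)" by (simp add: power_add mult_ac)
    then have "a ^ (k + l) * (x * y) \<in> B" using is_subringD(4)[OF B kl] by (simp only:)
    then show "x * y \<in> {x. \<exists>k. a ^ k * x \<in> B}" by blast
    have "a ^ (k + l) * (x + y) = a ^ l * (a ^ k * x) + a ^ k * (a ^ l * y)"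
      by (simp add: power_add algebra_simps)
    moreover have "a ^ l * (a ^ k * x) + a ^ k * (a ^ l * y) \<in> B"
      by (intro is_subringD(4,5)[OF B] kl is_subring_power[OF B] a(1))
    ultimately have "a ^ (k + l) * (x + y) \<in> B" by (simp only:)
    then show "x + y \<in> {x. \<exists>k. a ^ k * x \<in> B}" by blast
  next
    fix x assume "x \<in> {x. \<exists>k. a ^ k * x \<in> B}"
    then obtain k where "a ^ k * x \<in> B" by blast
    then have "a ^ k * (- x) \<in> B" using is_subringD(3)[OF B] by simp
    then show "- x \<in> {x. \<exists>k. a ^ k * x \<in> B}" by blast
  qed
  moreover have "insert (inverse a) B \<subseteq> {x. \<exists>k. a ^ k * x \<in> B}"
  proof -
    have "a ^ 1 * inverse a \<in> B" using a is_subringD(2)[OF B] by simp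
    moreover have "a ^ 0 * b \<in> B" if "b \<in> B" for b using that by simp
    ultimately show ?thesis by blast
  qed
  ultimately have "adjoin_inverse B a \<subseteq> {x. \<exists>k. a ^ k * x \<in> B}"
    unfolding adjoin_inverse_def by (rule generate_ring_subset)
  then show ?thesis using x by blast
qed

theorem mainTheorem6:
  fixes G :: "('g, 'x) monoid_scheme"
    and \<phi> :: "'g \<Rightarrow> 'l::field \<Rightarrow> 'l"
    and K R B :: "'l set"
    and \<alpha> :: "'l list"
    and I :: "'l mpol set"
    and Ib fs :: "'l mpol list"
    and a :: 'l
  assumes action: "acts_by_automorphisms G \<phi>"
    and K_subring: "subring K (ring_on (UNIV :: 'l set))"
    and K_fixed: "K \<subseteq> fixed_points G \<phi> UNIV"
    and K_zacharias: "zacharias_ring K"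
    and R_def: "R = subalg K (set \<alpha>)"
    and R_stable: "\<forall>\<sigma>\<in>carrier G. \<phi> \<sigma> ` R \<subseteq> R"
    and R_quot: "\<forall>x. \<exists>p\<in>R. \<exists>q\<in>R. q \<noteq> 0 \<and> x = p / q"
    and I_def: "I = a_kernel (ring_on (polys K (y_vars (length \<alpha>)))) (ring_on R) (at_y \<alpha>)"
    and I_basis: "set Ib \<subseteq> I" "I = genideal (ring_on (polys K (y_vars (length \<alpha>)))) (set Ib)"
    and fs: "set fs \<subseteq> polys K (y_vars (length \<alpha>))"
    and B_def: "B = subalg K (at_y \<alpha> ` set fs)"
    and B_inv: "B \<subseteq> fixed_points G \<phi> R"
    and a: "a \<in> B" "a \<noteq> 0"
    and localization: "adjoin_inverse (fixed_points G \<phi> R) a = adjoin_inverse B a"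
  shows
    "(\<forall>bs J. reachable K \<alpha> Ib a fs (Returned bs J)
         \<longrightarrow> subalg K (set bs) = fixed_points G \<phi> R \<and> J = relation_ideal K bs)
     \<and> (\<forall>s. reachable K \<alpha> Ib a fs s \<and> \<not> returned s \<longrightarrow> (\<exists>s'. step K \<alpha> Ib a s s'))
     \<and> (\<forall>fs' g hs rems new. reachable K \<alpha> Ib a fs (At_8 fs' g hs rems new)
         \<longrightarrow> length rems = length hs \<and> length new = length hs
             \<and> (\<forall>i<length hs. rems ! i = 0 \<and> new ! i \<in> polys K (y_vars (length \<alpha>))
                  \<and> at_z (map (at_y \<alpha>) fs') g * at_y \<alpha> (new ! i) = at_z (map (at_y \<alpha>) fs') (hs ! i)))
     \<and> (\<forall>\<rho>. execution K \<alpha> Ib a fs \<rho>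
         \<longrightarrow> ((\<exists>t. returned (\<rho> t)) \<longleftrightarrow> fin_gen_algebra K (fixed_points G \<phi> R)))"
proof -
  let ?Inv = "fixed_points G \<phi> R"
  note fixed = fixed_points_iff[OF action]
  have R: "is_subring R" unfolding R_def by (rule is_subring_subalg)
  have KR: "K \<subseteq> R" unfolding R_def using subalg_incl[of K "set \<alpha>"] by blast
  have B_subring: "is_subring B" unfolding B_def by (rule is_subring_subalg)
  have I: "ideal_I K \<alpha> = I" by (simp add: ideal_I_def I_def R_def)
  have I_poly: "I \<subseteq> polys K (y_vars (length \<alpha>))" unfolding I_def a_kernel_def' by auto
  interpret invariant_procedure K \<alpha> ?Inv B Ib a
  proof (intro invariant_procedure.intro generated_algebra.intro invariant_procedure_axioms.intro)
    show "is_subring K" by (rule K_subring)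
    show "noetherian_on K"
      using K_zacharias noetherian_on_of_noetherian_ring[OF K_subring] by (simp add: zacharias_ring_def)
    show "is_subring ?Inv" by (rule is_subring_fixed_points[OF action R])
    show "K \<subseteq> ?Inv" using subsetD[OF K_fixed] subsetD[OF KR] by (auto simp: fixed)
    show "?Inv \<subseteq> subalg K (set \<alpha>)" by (auto simp: fixed R_def)
    show "a \<in> B" "a \<noteq> 0" "B \<subseteq> ?Inv" by fact+
    show "x \<in> ?Inv" if x: "x \<in> subalg K (set \<alpha>)" "a * x \<in> ?Inv" for x
    proof -
      have fix_x: "\<phi> \<sigma> x = x" if \<sigma>: "\<sigma> \<in> carrier G" for \<sigma>
      proof -
        have "\<phi> \<sigma> a = a" using subsetD[OF B_inv a(1)] \<sigma> by (simp add: fixed)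
        moreover have "\<phi> \<sigma> (a * x) = a * x" using x(2) \<sigma> by (simp add: fixed)
        ultimately have "a * \<phi> \<sigma> x = a * x" by (simp add: automorphism_simps[OF action \<sigma>])
        then show ?thesis using a(2) by simp
      qed
      show ?thesis using x(1) fix_x by (simp add: fixed R_def)
    qed
    show "\<exists>k. a ^ k * x \<in> B" if "x \<in> ?Inv" for x
    proof (rule adjoin_inverse_clear[OF B_subring a])
      have "x \<in> adjoin_inverse ?Inv a"
        unfolding adjoin_inverse_def using that by (intro generate_ring.incl) blast
      then show "x \<in> adjoin_inverse B a" by (simp only: localization)
    qed
    show "set Ib \<subseteq> ideal_I K \<alpha>" using I_basis(1) I by simp
    show "ideal_I K \<alpha> = ideal_span (polys K (y_vars (length \<alpha>))) (set Ib)"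
      unfolding I using I_basis I_poly genideal_eq_ideal_span[OF is_subring_polys[OF K_subring]] by simp
  qed
  have adm: "admissible fs"
    unfolding admissible_def alg_def B_def[symmetric] using fs B_inv by simp
  note inv = invariant_reachable[OF _ adm]
  show ?thesis
  proof (intro conjI allI impI)
    fix bs J assume "reachable K \<alpha> Ib a fs (Returned bs J)"
    from inv[OF this] show "subalg K (set bs) = ?Inv" "J = relation_ideal K bs" by simp_all
  next
    fix s assume "reachable K \<alpha> Ib a fs s \<and> \<not> returned s"
    then show "\<exists>s'. step K \<alpha> Ib a s s'" using inv progress by blast
  next
    fix fs' g hs rems new assume "reachable K \<alpha> Ib a fs (At_8 fs' g hs rems new)"
    from inv[OF this] have d: "divided_by_a fs' g hs rems new" by simp
    then show "length rems = length hs" "length new = length hs" by (simp_all add: divided_by_a_def)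
    fix i assume "i < length hs"
    with d show "rems ! i = 0" "new ! i \<in> polys K (y_vars (length \<alpha>))"
      "at_z (map (at_y \<alpha>) fs') g * at_y \<alpha> (new ! i) = at_z (map (at_y \<alpha>) fs') (hs ! i)"
      by (simp_all add: divided_by_a_def)
  next
    fix \<rho> assume "execution K \<alpha> Ib a fs \<rho>"
    then show "(\<exists>t. returned (\<rho> t)) \<longleftrightarrow> fin_gen_algebra K ?Inv"
      using termination_if_finitely_generated[OF adm] returned_fin_gen[OF adm] by blast
  qed
qed

end
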